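(* Let $(A,B)$ be a pair of real random variables with $A\ge 0$, $A\not\equiv 1$. Let $\kappa>0$ and assume: (1) $\theta:=\mathbf{E}A^\kappa<1$ (and $\theta>0$); (2) $F_\kappa\in\mathcal{S}_{loc}$; (3) with $\Delta=(0,1]$, $\sup_{y>x}F_\kappa(y+\Delta)=O(F_\kappa(x+\Delta))$ for $x$ large enough, i.e. there are constants $K,x_0$ with $\sup_{y>x}F_\kappa(y+\Delta)\le K F_\kappa(x+\Delta)$ for all $x\ge x_0$; (4) the law of $\log A$ conditioned on $A\ne0$ is nonarithmetic; (5) $\mathbf{E}|B|^\nu<\infty$ for some $\nu>\kappa$; (6) $\mathbf{P}\{Ax+B=x\}<1$ for every $x\in\mathbb{R}$. Let $X$ be the solution of the perpetuity equation $X\stackrel{\mathcal D}{=}AX+B$, where on the right-hand side $(A,B)$ and $X$ are independent, and put $g(x)=F_\kappa(x+1)-F_\kappa(x)$. Then $$\lim_{x\to\infty}g(\log x)^{-1}x^\kappa\,\mathbf{P}\{X>x\}=\frac{\theta}{(1-\theta)^2\kappa}\,\mathbf{E}\big[(AX+B)_+^\kappa-(AX)_+^\kappa\big],$$ $$\lim_{x\to\infty}g(\log x)^{-1}x^\kappa\,\mathbf{P}\{X\le-x\}=\frac{\theta}{(1-\theta)^2\kappa}\,\mathbf{E}\big[(AX+B)_-^\kappa-(AX)_-^\kappa\big].$$ Moreover, $$\mathbf{E}\big[(AX+B)_+^\kappa-(AX)_+^\kappa\big]+\mathbf{E}\big[(AX+B)_-^\kappa-(AX)_-^\kappa\big]>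0.$$
   Context: Notation: $x_+=\max\{x,0\}$, $x_-=\max\{-x,0\}$, $\log 0=-\infty$. $F_\kappa$ is the probability distribution function $F_\kappa(x)=\theta^{-1}\mathbf{E}[I(\log A\le x)A^\kappa]$, $x\in\mathbb{R}$, where $\theta=\mathbf{E}A^\kappa$. For $T\in(0,\infty)$ let $\Delta=(0,T]$, and for a distribution function $H$ on $\mathbb{R}$ put $H(x+\Delta)=H(x+T)-H(x)$. $H\in\mathcal{L}_\Delta$ if $H(x+t+\Delta)/H(x+\Delta)\to1$ as $x\to\infty$ uniformly in $t\in[0,1]$. $H\in\mathcal{S}_\Delta$ ($\Delta$-subexponential) if $H(x+\Delta)>0$ for all $x$ large enough, $H\in\mathcal{L}_\Delta$, and $(H*H)(x+\Delta)\sim2H(x+\Delta)$ as $x\to\infty$. $H\in\mathcal{S}_{loc}$ (locally subexponential) if $H\in\mathcal{S}_\Delta$ for every $T>0$. "The solution" refers to the law of $X$; under these assumptions it is known to exist and be unique. In the expectations, $X$ is independent of $(A,B)$. *)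

theory Defs
  imports "HOL-Probability.Probability" "HOL-Library.Landau_Symbols"
begin

section \<open>Local subexponentiality\<close>

text \<open>
  The increment \<open>H(x + \<Delta>)\<close> for \<open>\<Delta> = (0, T]\<close>. In this section \<open>H\<close> stands for the distribution
  function of a probability law on the reals; that law is then \<open>interval_measure H\<close>, and
  \<open>H * H\<close> is a Stieltjes convolution of laws.
\<close>

definition incr :: "(real \<Rightarrow> real) \<Rightarrow> real \<Rightarrow> real \<Rightarrow> real" where
  "incr H T x = H (x + T) - H x"

definition df_convolution :: "(real \<Rightarrow> real) \<Rightarrow> (real \<Rightarrow> real) \<Rightarrow> real \<Rightarrow> real" where
  "df_convolution G H = cdf (convolution (interval_measure G) (interval_measure H))"

definition delta_long_tailed :: "real \<Rightarrow> (real \<Rightarrow> real) \<Rightarrow> bool" where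
  "delta_long_tailed T H \<longleftrightarrow>
     uniform_limit {0..1} (\<lambda>x t. incr H T (x + t) / incr H T x) (\<lambda>t. 1) at_top"

definition delta_subexponential :: "real \<Rightarrow> (real \<Rightarrow> real) \<Rightarrow> bool" where
  "delta_subexponential T H \<longleftrightarrow>
     (\<forall>\<^sub>F x in at_top. incr H T x > 0) \<and>
     delta_long_tailed T H \<and>
     (\<lambda>x. incr (df_convolution H H) T x) \<sim>[at_top] (\<lambda>x. 2 * incr H T x)"

definition locally_subexponential :: "(real \<Rightarrow> real) \<Rightarrow> bool" where
  "locally_subexponential H \<longleftrightarrow> (\<forall>T>0. delta_subexponential T H)"

section \<open>The tilted distribution function of the logarithm\<close>

definition moment :: "'a measure \<Rightarrow> ('a \<Rightarrow> real) \<Rightarrow> real \<Rightarrow> real" where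
  "moment M A \<kappa> = (\<integral>\<omega>. A \<omega> powr \<kappa> \<partial>M)"

text \<open>
  The library has \<open>ln 0 = 0\<close>, whereas \<open>log 0\<close> is meant to be minus infinity; hence the disjunct
  \<open>A \<omega> = 0\<close> in the event \<open>log A \<le> x\<close>.
\<close>

definition tilted_df :: "'a measure \<Rightarrow> ('a \<Rightarrow> real) \<Rightarrow> real \<Rightarrow> real \<Rightarrow> real" where
  "tilted_df M A \<kappa> x =
     inverse (moment M A \<kappa>) *
       (\<integral>\<omega>. indicator {\<omega>. A \<omega> = 0 \<or> ln (A \<omega>) \<le> x} \<omega> * A \<omega> powr \<kappa> \<partial>M)"

text \<open>\<open>tilted_df M A \<kappa>\<close> is a distribution function, so the notions above apply to it.\<close>

lemma tilted_df_distribution_function: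
  fixes A :: "'a \<Rightarrow> real"
  assumes [measurable]: "A \<in> borel_measurable M"
    and int: "integrable M (\<lambda>\<omega>. A \<omega> powr \<kappa>)"
    and pos: "moment M A \<kappa> > 0"
  shows "real_distribution (interval_measure (tilted_df M A \<kappa>))"
    and "cdf (interval_measure (tilted_df M A \<kappa>)) = tilted_df M A \<kappa>"
proof -
  define th where "th = moment M A \<kappa>"
  have th: "th > 0" and th_eq: "(\<integral>\<omega>. A \<omega> powr \<kappa> \<partial>M) = th"
    using pos by (simp_all add: th_def moment_def)
  define D where "D = density M (\<lambda>\<omega>. ennreal (A \<omega> powr \<kappa> / th))"
  define N where "N = distr D borel (\<lambda>\<omega>. ln (A \<omega>))"
  have "(\<integral>\<^sup>+\<omega>. ennreal (A \<omega> powr \<kappa> / th) \<partial>M) = ennreal (\<integral>\<omega>. A \<omega> powr \<kappa> / th \<partial>M)"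
    using int th by (intro nn_integral_eq_integral) auto
  also have "\<dots> = 1"
    using th th_eq by simp
  finally have "emeasure D (space D) = 1"
    by (simp add: D_def emeasure_density cong: nn_integral_cong)
  then interpret D: prob_space D
    by (rule prob_spaceI)
  have [measurable]: "A \<in> borel_measurable D"
    by (simp add: D_def)
  interpret N: real_distribution N
    unfolding N_def by (rule D.real_distribution_distr) simp
  have cdfN: "cdf N x = tilted_df M A \<kappa> x" for x
  proof -
    have "cdf N x = measure D {\<omega> \<in> space M. ln (A \<omega>) \<le> x}"
      unfolding cdf_def N_def by (subst measure_distr) (auto simp: D_def vimage_def intro!: arg_cong2[where f=measure])
    also have "\<dots> = (\<integral>\<omega>. A \<omega> powr \<kappa> / th * indicator {\<omega> \<in> space M. ln (A \<omega>) \<le> x} \<omega> \<partial>M)"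
    proof -
      have "emeasure D {\<omega> \<in> space M. ln (A \<omega>) \<le> x}
            = (\<integral>\<^sup>+\<omega>. ennreal (A \<omega> powr \<kappa> / th * indicator {\<omega> \<in> space M. ln (A \<omega>) \<le> x} \<omega>) \<partial>M)"
        unfolding D_def
        by (subst emeasure_density) (auto intro!: nn_integral_cong split: split_indicator)
      also have "\<dots> = ennreal (\<integral>\<omega>. A \<omega> powr \<kappa> / th * indicator {\<omega> \<in> space M. ln (A \<omega>) \<le> x} \<omega> \<partial>M)"
        using int th
        by (intro nn_integral_eq_integral integrable_real_mult_indicator) auto
      finally show ?thesis
        using th unfolding measure_def by (simp add: enn2real_ennreal integral_nonneg_AE)
    qed
    also have "\<dots> = (\<integral>\<omega>. inverse th * (indicator {\<omega>. A \<omega> = 0 \<or> ln (A \<omega>) \<le> x} \<omega> * A \<omega> powr \<kappa>) \<partial>M)"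
      by (intro Bochner_Integration.integral_cong) (auto simp: field_simps split: split_indicator)
    also have "\<dots> = tilted_df M A \<kappa> x"
      by (simp add: tilted_df_def th_def)
    finally show ?thesis .
  qed
  have eq: "tilted_df M A \<kappa> = cdf N"
    using cdfN by auto
  show "real_distribution (interval_measure (tilted_df M A \<kappa>))"
    unfolding eq
    by (intro real_distribution_interval_measure N.cdf_nondecreasing N.cdf_is_right_cont
        N.cdf_lim_at_bot N.cdf_lim_at_top_prob)
  show "cdf (interval_measure (tilted_df M A \<kappa>)) = tilted_df M A \<kappa>"
    unfolding eq
    by (intro cdf_interval_measure N.cdf_nondecreasing N.cdf_is_right_cont N.cdf_lim_at_bot)
qed

text \<open>A law is arithmetic if it is carried by the lattice \<open>h \<int>\<close> for some \<open>h > 0\<close>.\<close>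

definition nonarithmetic :: "real measure \<Rightarrow> bool" where
  "nonarithmetic \<mu> \<longleftrightarrow> \<not> (\<exists>h>0. AE x in \<mu>. \<exists>k::int. x = h * of_int k)"

definition cond_log_law :: "'a measure \<Rightarrow> ('a \<Rightarrow> real) \<Rightarrow> real measure" where
  "cond_log_law M A =
     distr (uniform_measure M {\<omega> \<in> space M. A \<omega> \<noteq> 0}) borel (\<lambda>\<omega>. ln (A \<omega>))"

section \<open>The perpetuity equation\<close>

text \<open>
  \<open>\<mu>\<close> is the law of \<open>X\<close>. The independence of \<open>X\<close> and \<open>(A, B)\<close> is realised by the product
  \<open>M \<Otimes>\<^sub>M \<mu>\<close>, whose second coordinate plays the role of \<open>X\<close>.
\<close>

definition perpetuity_solution ::
    "'a measure \<Rightarrow> ('a \<Rightarrow> real) \<Rightarrow> ('a \<Rightarrow> real) \<Rightarrow> real measure \<Rightarrow> bool" where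
  "perpetuity_solution M A B \<mu> \<longleftrightarrow>
     real_distribution \<mu> \<and> distr (M \<Otimes>\<^sub>M \<mu>) borel (\<lambda>(\<omega>, x). A \<omega> * x + B \<omega>) = \<mu>"

definition pos_part :: "real \<Rightarrow> real" where
  "pos_part x = max x 0"

definition neg_part :: "real \<Rightarrow> real" where
  "neg_part x = max (- x) 0"

definition goldie_integrand ::
    "(real \<Rightarrow> real) \<Rightarrow> ('a \<Rightarrow> real) \<Rightarrow> ('a \<Rightarrow> real) \<Rightarrow> real \<Rightarrow> 'a \<times> real \<Rightarrow> real" where
  "goldie_integrand \<phi> A B \<kappa> =
     (\<lambda>(\<omega>, x). \<phi> (A \<omega> * x + B \<omega>) powr \<kappa> - \<phi> (A \<omega> * x) powr \<kappa>)"

end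

theory Submission
  imports Defs
begin

text \<open>
  Let \<open>\<phi>\<close> be the positive or the negative part and \<open>f x = exp (\<kappa> * x) * P(\<phi> X > exp x)\<close>. A truncation
  argument gives \<open>E |X|^\<kappa> < \<infinity>\<close>, so \<open>f\<close> is integrable and the Goldie expectation is
  \<open>(1 - \<theta>) * E (\<phi> X)^\<kappa>\<close>; positivity follows at once. The perpetuity equation says that
  \<open>f - \<theta> * (F \<star> f)\<close> is exponentially small after averaging over a window, hence negligible with
  respect to the long-tailed \<open>g\<close>. No renewal measure is needed to solve this equation: if
  \<open>u\<close> is the windowed version of \<open>f\<close> with total mass \<open>I\<close> and \<open>u \<approx> c * g\<close> up to an error \<open>\<beta> * g\<close>,
  then local subexponentiality gives \<open>F \<star> u \<approx> (I + c) * g\<close> up to \<open>\<beta> * g\<close>. For the fixed point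
  \<open>c = \<theta> * (I + c)\<close> the error is therefore contracted by the factor \<open>\<theta> < 1\<close>. Shrinking the window
  and using monotonicity of the tail yields the asymptotics of \<open>f\<close> itself.
\<close>

section \<open>Elementary inequalities\<close>

text \<open>Subexponentiality controls masses of windows, so f has to enter as the density of a
  finite measure, \<open>trunc_measure\<close>. The two summands of I + c come from cutting the
  convolution at a fixed level K of x - y. Where x - y \<le> K, the kernel makes the large jump and
  only the total mass I of u remains visible. Where x - y > K, u is close to c * g, and the relation
  F * F ~ 2 F on windows leaves exactly one g. Only this second piece carries the error \<beta>,
  hence the contraction by \<theta>.

  A contraction needs a finite bound to start from, but neither the \<kappa>-th moment of X nor sup
  u / g is known to be finite beforehand. Both quantities are regularised, by truncation and by an
  added constant, then bounded uniformly by iteration before the regularisation is removed.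

  Moments of X of an order p > \<kappa> may be infinite, yet the p-th powers of \<phi> (A X + B) and
  \<phi> (A X) have an integrable difference for a suitable p. The surplus p - \<kappa> turns into
  exponential decay, which every long-tailed g dominates.\<close>

lemma affine_iteration_bound:
  fixes P :: "real \<Rightarrow> bool" and \<rho> C :: real
  assumes start: "P \<beta>0" "\<beta>0 \<ge> 0" and step: "\<And>\<beta>. \<beta> \<ge> 0 \<Longrightarrow> P \<beta> \<Longrightarrow> P (\<rho> * \<beta> + C)"
    and mono: "\<And>\<beta> \<beta>'. \<beta> \<le> \<beta>' \<Longrightarrow> P \<beta> \<Longrightarrow> P \<beta>'"
    and "0 \<le> \<rho>" "\<rho> < 1" "C \<ge> 0" and "\<beta> > C / (1 - \<rho>)"
  shows "P \<beta>"
proof -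
  \<comment> \<open>The orbit of the affine map started at
    \<open>\<beta>0 + C / (1 - \<rho>)\<close>: enlarging the start is free by monotonicity and
    makes the closed form exact. The strict inequality in the claim pays for never reaching the
    fixed point.\<close>
  have iter: "P (C / (1 - \<rho>) + \<rho> ^ n * \<beta>0)" for n
  proof (induction n)
    case 0
    then show ?case
      using assms by (intro mono[OF _ start(1)]) auto
  next
    case (Suc n)
    have "P (\<rho> * (C / (1 - \<rho>) + \<rho> ^ n * \<beta>0) + C)"
      using assms by (intro step Suc) auto
    moreover have "\<rho> * (C / (1 - \<rho>) + \<rho> ^ n * \<beta>0) + C = C / (1 - \<rho>) + \<rho> ^ Suc n * \<beta>0"
      using assms by (simp add: field_simps)
    ultimately show ?case by simp
  qed
  have "(\<lambda>n. C / (1 - \<rho>) + \<rho> ^ n * \<beta>0) \<longlonglongrightarrow> C / (1 - \<rho>) + 0 * \<beta>0"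
    using assms by (intro tendsto_intros LIMSEQ_power_zero) auto
  then have "\<forall>\<^sub>F n in sequentially. C / (1 - \<rho>) + \<rho> ^ n * \<beta>0 < \<beta>"
    using assms by (intro order_tendstoD(2)) auto
  then obtain n where "C / (1 - \<rho>) + \<rho> ^ n * \<beta>0 < \<beta>"
    by (auto simp: eventually_sequentially)
  then show ?thesis
    using mono[OF _ iter[of n]] by simp
qed

text \<open>For s \<ge> 1, exp (- t) \<ge> 1 - t at t = p * ln s gives the slope
  \<open>p * 2 powr p\<close>; for s < 1, Bernoulli's inequality with the integer exponent
  \<lceil>p\<rceil> \<le> p + 1 gives the rest of the constant. Comparing with the point 1 avoids
  the infinite slope at 0 when p < 1.\<close>

lemma powr_diff_one_le:
  fixes p s :: real
  assumes "p > 0" "0 \<le> s" "s \<le> 2"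
  shows "\<bar>s powr p - 1\<bar> \<le> (p * 2 powr p + p + 1) * \<bar>s - 1\<bar>"
proof (cases "s \<ge> 1")
  case True
  have "s powr p * (1 - p * ln s) \<le> s powr p * exp (- (p * ln s))"
    using exp_ge_add_one_self[of "- (p * ln s)"] by (intro mult_left_mono) auto
  also have "\<dots> = 1"
    using True by (simp add: powr_def flip: exp_add)
  finally have "s powr p - 1 \<le> p * ln s * s powr p"
    by (simp add: algebra_simps)
  also have "\<dots> \<le> p * (s - 1) * 2 powr p"
    using True assms ln_le_minus_one[of s] by (intro mult_mono powr_mono2) auto
  also have "\<dots> \<le> (p * 2 powr p + p + 1) * (s - 1)"
    using mult_nonneg_nonneg[of "p + 1" "s - 1"] True assms by (simp add: algebra_simps)
  finally show ?thesis
    using True assms ge_one_powr_ge_zero[of s p] by simp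
next
  case False
  define n where "n = nat \<lceil>p\<rceil>"
  have n: "n > 0" "p \<le> real n" "real n \<le> p + 1" using assms(1) by (auto simp: n_def)
  have "1 + real n * (s - 1) \<le> (1 + (s - 1)) ^ n"
    using assms by (intro Bernoulli_inequality) auto
  also have "\<dots> \<le> s powr p"
  proof (cases "s = 0")
    case False
    then show ?thesis
      using n \<open>\<not> s \<ge> 1\<close> assms by (simp add: powr_mono' flip: powr_realpow)
  qed (use n in \<open>simp add: power_0_left\<close>)
  finally have "1 - s powr p \<le> real n * (1 - s)" by (simp add: algebra_simps)
  also have "\<dots> \<le> (p * 2 powr p + p + 1) * (1 - s)"
    using n False assms by (intro mult_right_mono) (auto intro: order_trans[OF n(3)])
  finally show ?thesis
    using False assms powr_le1[of p s] by simp
qed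

text \<open>
  The exponent \<open>p > \<kappa>\<close> is chosen such that \<open>p - 1 + p / \<nu> = \<kappa>\<close>; the two regimes are
  \<open>c \<ge> b powr (p / \<nu>)\<close> and \<open>c < b powr (p / \<nu>)\<close>.
\<close>

lemma powr_perturbation_bound:
  fixes \<kappa> \<nu> :: real
  assumes "0 < \<kappa>" "\<kappa> < \<nu>"
  defines "p \<equiv> \<nu> * (\<kappa> + 1) / (\<nu> + 1)"
  shows "\<exists>C\<ge>0. \<forall>a b c. 0 \<le> a \<longrightarrow> 0 \<le> b \<longrightarrow> \<bar>a - b\<bar> \<le> c \<longrightarrow>
    \<bar>a powr p - b powr p\<bar> \<le> C * (1 + b powr \<kappa> + c powr \<nu>)"
proof -
  define \<sigma> where "\<sigma> = (\<kappa> + 1) / (\<nu> + 1)"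
  have "\<sigma> * (\<nu> + 1) = \<kappa> + 1" using assms by (simp add: \<sigma>_def)
  moreover have "p = \<sigma> * \<nu>" by (simp add: p_def \<sigma>_def)
  moreover have "0 < \<sigma>" "\<sigma> < 1" using assms by (simp_all add: \<sigma>_def)
  ultimately have \<sigma>: "0 < \<sigma>" "\<sigma> < 1" "p = \<sigma> * \<nu>" "p - 1 + \<sigma> = \<kappa>"
    by (auto simp: algebra_simps)
  have p: "p > 0" "p < \<nu>" using \<sigma> assms by auto
  define C1 where "C1 = p * 2 powr p + p + 1"
  have C1: "C1 \<ge> 0" using p by (simp add: C1_def)
  define C where "C = C1 + 2 * 2 powr p + 1"
  have "\<bar>a powr p - b powr p\<bar> \<le> C * (1 + b powr \<kappa> + c powr \<nu>)"
    if abc: "0 \<le> a" "0 \<le> b" "\<bar>a - b\<bar> \<le> c" for a b c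
  proof -
    have nn: "0 \<le> b powr \<kappa>" "0 \<le> c powr \<nu>" "0 \<le> (2::real) powr p" by auto
    consider "c \<ge> b powr \<sigma>" | "c < b powr \<sigma>" "b < 1" | "c < b powr \<sigma>" "b \<ge> 1" by linarith
    then show ?thesis
    proof cases
      case 1
      \<comment> \<open>In this regime c controls b, because p = \<sigma> * \<nu> makes
        \<open>b powr p\<close> the \<nu>-th power of \<open>b powr \<sigma>\<close>.\<close>
      have bp: "b powr p \<le> c powr \<nu>"
        using powr_mono2[OF _ _ 1, of \<nu>] assms by (simp add: powr_powr \<sigma>)
      have cp: "c powr p \<le> 1 + c powr \<nu>"
      proof (cases "c \<ge> 1")
        case True
        then show ?thesis using p powr_mono[of p \<nu> c] by simp
      next
        case False
        then have "c powr p \<le> 1" using p abc by (intro powr_le1) auto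
        then show ?thesis using nn by linarith
      qed
      have "a powr p \<le> (2 * max b c) powr p"
        using p abc by (intro powr_mono2) auto
      also have "\<dots> = 2 powr p * max b c powr p"
        by (rule powr_mult)
      also have "\<dots> \<le> 2 powr p * (1 + c powr \<nu>)"
        using bp cp by (intro mult_left_mono) (auto simp: max_def)
      finally have ap: "a powr p \<le> 2 powr p * (1 + c powr \<nu>)" .
      have "\<bar>u - v\<bar> \<le> U + V" if "0 \<le> u" "0 \<le> v" "u \<le> U" "v \<le> V" for u v U V :: real
        using that by linarith
      then have "\<bar>a powr p - b powr p\<bar> \<le> 2 powr p * (1 + c powr \<nu>) + c powr \<nu>"
        using ap bp by simp
      also have "\<dots> \<le> (2 powr p + 1) * (1 + c powr \<nu>)"
        by (simp add: algebra_simps)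
      also have "\<dots> \<le> C * (1 + b powr \<kappa> + c powr \<nu>)"
        using C1 by (intro mult_mono) (auto simp: C_def)
      finally show ?thesis .
    next
      case 2
      have "b powr \<sigma> \<le> 1" using 2 \<sigma> abc by (intro powr_le1) auto
      then have "a \<le> 2" using 2 abc by linarith
      then have "a powr p \<le> 2 powr p" using p abc by (intro powr_mono2) auto
      moreover have "b powr p \<le> 2 powr p" using p abc 2 by (intro powr_mono2) auto
      moreover have "a powr p \<ge> 0" "b powr p \<ge> 0" by auto
      ultimately have "\<bar>a powr p - b powr p\<bar> \<le> 2 powr p * 1" by linarith
      also have "\<dots> \<le> C * (1 + b powr \<kappa> + c powr \<nu>)"
        using C1 by (intro mult_mono) (auto simp: C_def)
      finally show ?thesis .
    next
      case 3
      \<comment> \<open>From c \<le> b the ratio a / b lies in [0, 2], where the linear estimate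
        around 1 applies. It bounds the difference by \<open>C1 * b powr (p - 1) * c\<close>, and c
        < \<open>b powr \<sigma>\<close> turns this into
        \<open>C1 * b powr \<kappa>\<close>.\<close>
      have "b powr \<sigma> \<le> b powr 1" using 3 \<sigma> by (intro powr_mono) auto
      then have cb: "c \<le> b" using 3 by simp
      have "\<bar>a powr p - b powr p\<bar> = b powr p * \<bar>(a / b) powr p - 1\<bar>"
        using 3 abc by (simp add: powr_divide abs_mult_pos' right_diff_distrib)
      also have "\<dots> \<le> b powr p * (C1 * \<bar>a / b - 1\<bar>)"
        unfolding C1_def using 3 abc cb p
        by (intro mult_left_mono powr_diff_one_le) (auto simp: field_simps)
      also have "\<bar>a / b - 1\<bar> \<le> c / b"
        using 3 abc by (simp add: abs_le_iff field_simps)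
      also have "c / b \<le> b powr \<sigma> / b"
        using 3 by (intro divide_right_mono) auto
      also have "b powr p * (C1 * (b powr \<sigma> / b)) = C1 * b powr (p + \<sigma> - 1)"
        using 3 by (simp add: powr_add powr_diff)
      also have "p + \<sigma> - 1 = \<kappa>" using \<sigma> by simp
      also have "C1 * b powr \<kappa> \<le> C * (1 + b powr \<kappa> + c powr \<nu>)"
        using C1 by (intro mult_mono) (auto simp: C_def)
      finally show ?thesis using C1 by (simp add: mult_left_mono)
    qed
  qed
  moreover have "C \<ge> 0" using C1 by (simp add: C_def)
  ultimately show ?thesis by blast
qed

text \<open>Up to the common constant \<open>l powr \<kappa>\<close>, both increments are
  \<kappa>-th powers of the argument clamped to [l, r]. Beyond l, increments of p-th powers are at
  least \<open>l powr (p - \<kappa>)\<close> times those of \<kappa>-th powers, and clamping only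
  shrinks them. With l = exp x the surplus exponent becomes exponential decay.\<close>

lemma truncated_powr_diff_le:
  fixes \<kappa> p l r v w :: real
  assumes "0 < \<kappa>" "\<kappa> \<le> p" "0 < l" "l \<le> r" "0 \<le> v" "0 \<le> w"
  shows "l powr (p - \<kappa>) * \<bar>(min v r powr \<kappa> - min v l powr \<kappa>) - (min w r powr \<kappa> - min w l powr \<kappa>)\<bar>
    \<le> \<bar>v powr p - w powr p\<bar>"
  using assms(5,6)
proof (induction v w rule: linorder_wlog)
  case (le w v)
  define cl where "cl z = max l (min z r)" for z
  have cl_eq: "min z r powr \<kappa> - min z l powr \<kappa> = cl z powr \<kappa> - l powr \<kappa>" for z
    using assms by (auto simp: cl_def min_def max_def)
  have cl: "l \<le> cl w" "cl w \<le> cl v" using le assms by (auto simp: cl_def)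
  have mono: "cl w powr \<kappa> \<le> cl v powr \<kappa>" using cl assms by (intro powr_mono2) auto
  have split: "z powr p = z powr (p - \<kappa>) * z powr \<kappa>" for z :: real
    by (simp flip: powr_add)
  have "l powr (p - \<kappa>) * (cl v powr \<kappa> - cl w powr \<kappa>) \<le> cl w powr (p - \<kappa>) * (cl v powr \<kappa> - cl w powr \<kappa>)"
    using cl mono assms by (intro mult_right_mono powr_mono2) auto
  also have "\<dots> = cl w powr (p - \<kappa>) * cl v powr \<kappa> - cl w powr p"
    by (simp add: split[of "cl w"] right_diff_distrib)
  also have "\<dots> \<le> cl v powr (p - \<kappa>) * cl v powr \<kappa> - cl w powr p"
    using cl assms by (intro diff_right_mono mult_right_mono powr_mono2) auto
  also have "\<dots> = cl v powr p - cl w powr p" by (simp add: split[of "cl v"])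
  also have "\<dots> \<le> v powr p - w powr p"
  proof -
    have "w powr p \<le> v powr p" using le assms by (intro powr_mono2) auto
    moreover have "cl v powr p \<le> v powr p" if "v > l"
      using that assms by (intro powr_mono2) (auto simp: cl_def)
    moreover have "w powr p \<le> cl w powr p" if "w < r"
      using that assms le by (intro powr_mono2) (auto simp: cl_def)
    moreover have "cl v = cl w" if "v \<le> l \<or> w \<ge> r"
      using that le assms by (auto simp: cl_def)
    ultimately show ?thesis by (cases "v \<le> l \<or> w \<ge> r") auto
  qed
  finally show ?case
    using mono by (simp add: cl_eq abs_if algebra_simps)
next
  case (sym v w)
  then show ?case by (simp add: abs_minus_commute)
qed

section \<open>A renewal equation with locally subexponential kernel\<close>

lemma (in finite_borel_measure) incr_cdf:
  assumes "T > 0"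
  shows "incr (cdf M) T x = measure M {x<..x + T}"
  using assms by (simp add: incr_def cdf_diff_eq)

lemma (in finite_borel_measure) incr_cdf_nonneg: "T > 0 \<Longrightarrow> incr (cdf M) T x \<ge> 0"
  by (simp add: incr_cdf)

lemma (in finite_borel_measure) incr_cdf_le: "T > 0 \<Longrightarrow> incr (cdf M) T x \<le> measure M UNIV"
  using bounded_measure[of "{x<..x + T}"] by (simp add: incr_cdf borel_UNIV)

lemma (in finite_borel_measure) borel_measurable_incr_cdf [measurable]:
  "incr (cdf M) T \<in> borel_measurable borel"
proof -
  have [measurable]: "cdf M \<in> borel_measurable borel"
    by (intro borel_measurable_mono monoI cdf_nondecreasing)
  show ?thesis
    unfolding incr_def by measurable
qed

text \<open>Fubini for the event z \<le> K, x < y + z \<le> x + T. After the swap the windows are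
  measured by N, whose long tail will be known, instead of Q, of which only finiteness is
  assumed.\<close>

lemma convolution_window_swap:
  assumes "finite_borel_measure N" "finite_borel_measure Q"
  shows "integrable N (\<lambda>y. measure Q ({..K} \<inter> {x - y<..x - y + T}))" (is ?int)
    and "(\<integral>z. indicator {..K} z * measure N {x - z<..x - z + T} \<partial>Q)
       = (\<integral>y. measure Q ({..K} \<inter> {x - y<..x - y + T}) \<partial>N)" (is ?eq)
proof -
  interpret N: finite_borel_measure N by fact
  interpret Q: finite_borel_measure Q by fact
  interpret P: pair_sigma_finite N Q ..
  interpret PF: finite_measure "N \<Otimes>\<^sub>M Q"
    by (intro finite_measure_pair_measure) unfold_locales
  note [measurable_cong] = N.M_is_borel Q.M_is_borel
  define f :: "real \<Rightarrow> real \<Rightarrow> real"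
    where "f y z = indicator {..K} z * indicator {x - y<..x - y + T} z" for y z
  have "(\<lambda>p. f (fst p) (snd p)) \<in> borel_measurable (N \<Otimes>\<^sub>M Q)"
    unfolding f_def indicator_def greaterThanAtMost_iff atMost_iff by measurable
  then have int: "integrable (N \<Otimes>\<^sub>M Q) (case_prod f)"
    by (intro PF.integrable_const_bound[where B = 1])
       (auto simp: f_def case_prod_beta' split: split_indicator)
  have inner: "(\<integral>z. f y z \<partial>Q) = measure Q ({..K} \<inter> {x - y<..x - y + T})" for y
    unfolding f_def indicator_inter_arith[symmetric] by (simp add: Q.borel_UNIV)
  have "(\<integral>y. f y z \<partial>N) = indicator {..K} z * measure N {x - z<..x - z + T}" for z
  proof -
    have "(\<integral>y. f y z \<partial>N) = (\<integral>y. indicator {..K} z * indicator {x - z<..x - z + T} y \<partial>N)"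
      unfolding f_def by (intro Bochner_Integration.integral_cong) (auto split: split_indicator)
    then show ?thesis by (simp add: N.borel_UNIV)
  qed
  then show ?eq
    using P.Fubini_integral[OF int] inner by simp
  show ?int
    using P.integrable_fst[OF int] inner by simp
qed

section \<open>Tail comparisons for a locally subexponential law\<close>

locale locally_subexponential_law = real_distribution N for N :: "real measure" +
  fixes g :: "real \<Rightarrow> real"
  defines "g \<equiv> incr (cdf N) 1"
  assumes loc_subexp: "locally_subexponential (cdf N)"
    and almost_decreasing: "\<exists>K x0. \<forall>x\<ge>x0. (SUP y\<in>{x<..}. g y) \<le> K * g x"
begin

lemma g_nonneg: "g x \<ge> 0"
  by (simp add: g_def incr_cdf_nonneg)

text \<open>Long-tailedness gives the shifts in [0, 1]. Composition reaches every s \<ge> 0, and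
  reciprocals give the negative shifts that occur when passing from x to x - z.\<close>

lemma incr_shift:
  assumes "T > 0"
  shows "((\<lambda>x. incr (cdf N) T (x + s) / incr (cdf N) T x) \<longlongrightarrow> 1) at_top"
proof -
  define h where "h = incr (cdf N) T"
  have sub: "delta_subexponential T (cdf N)"
    using loc_subexp assms by (simp add: locally_subexponential_def)
  then have pos: "\<forall>\<^sub>F x in at_top. h x > 0"
    by (simp add: delta_subexponential_def h_def)
  have unit: "((\<lambda>x. h (x + t) / h x) \<longlongrightarrow> 1) at_top" if "t \<in> {0..1}" for t
    using sub that unfolding delta_subexponential_def delta_long_tailed_def h_def
    by (auto dest: tendsto_uniform_limitI)
  have top: "filterlim (\<lambda>x. x + t) at_top at_top" for t :: real
    by (rule filterlim_at_top_mono[OF filterlim_tendsto_add_at_top[OF tendsto_const filterlim_ident, of t]])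
       (simp add: add.commute)
  have comp: "((\<lambda>x. h (x + (s + t)) / h x) \<longlongrightarrow> 1) at_top"
    if s: "((\<lambda>x. h (x + s) / h x) \<longlongrightarrow> 1) at_top" and t: "((\<lambda>x. h (x + t) / h x) \<longlongrightarrow> 1) at_top" for s t
  proof -
    have "((\<lambda>x. h (x + s + t) / h (x + s) * (h (x + s) / h x)) \<longlongrightarrow> 1 * 1) at_top"
      by (intro tendsto_mult s filterlim_compose[OF t top])
    moreover have "\<forall>\<^sub>F x in at_top. h (x + s) > 0"
      using pos top by (rule eventually_compose_filterlim)
    then have "\<forall>\<^sub>F x in at_top. h (x + s + t) / h (x + s) * (h (x + s) / h x) = h (x + (s + t)) / h x"
      by eventually_elim (simp add: add.assoc)
    ultimately have "((\<lambda>x. h (x + (s + t)) / h x) \<longlongrightarrow> 1 * 1) at_top"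
      by (rule Lim_transform_eventually)
    then show ?thesis by simp
  qed
  have nat: "((\<lambda>x. h (x + (real n + t)) / h x) \<longlongrightarrow> 1) at_top" if "t \<in> {0..1}" for n t
  proof (induction n)
    case 0
    then show ?case using unit[OF that] by simp
  next
    case (Suc n)
    then show ?case using comp[OF Suc unit[of 1]] by (simp add: algebra_simps)
  qed
  have nonneg: "((\<lambda>x. h (x + s) / h x) \<longlongrightarrow> 1) at_top" if "s \<ge> 0" for s
  proof -
    have "s = real (nat \<lfloor>s\<rfloor>) + frac s" "frac s \<in> {0..1}"
      using that by (auto simp: frac_def frac_ge_0 less_imp_le[OF frac_lt_1]) linarith+
    then show ?thesis using nat by metis
  qed
  have "((\<lambda>x. h (x + s) / h x) \<longlongrightarrow> 1) at_top"
  proof (cases "s \<ge> 0")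
    case False
    have "((\<lambda>x. inverse (h ((x + s) + - s) / h (x + s))) \<longlongrightarrow> inverse 1) at_top"
      using False by (intro tendsto_inverse filterlim_compose[OF nonneg top]) auto
    then show ?thesis by (simp add: divide_simps)
  qed (rule nonneg)
  then show ?thesis by (simp add: h_def)
qed

lemma g_pos: "\<forall>\<^sub>F x in at_top. g x > 0"
  using loc_subexp unfolding g_def locally_subexponential_def delta_subexponential_def by auto

lemma g_shift: "((\<lambda>x. g (x + s) / g x) \<longlongrightarrow> 1) at_top"
  using incr_shift[of 1] by (simp add: g_def)

text \<open>A unit window splits into n windows of length 1 / n, asymptotically equal by
  \<open>incr_shift\<close>, so each carries the share 1 / n of g. This is why the later windows
  have length 1 / n.\<close>

lemma incr_window_ratio:
  assumes n: "n > 0"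
  shows "((\<lambda>x. incr (cdf N) (1 / real n) (x + s) / g x) \<longlongrightarrow> 1 / real n) at_top"
proof -
  define T where "T = 1 / real n"
  define h where "h = incr (cdf N) T"
  have T: "T > 0" "real n * T = 1" using n by (auto simp: T_def)
  have h_pos: "\<forall>\<^sub>F x in at_top. h x > 0"
    using loc_subexp T unfolding h_def locally_subexponential_def delta_subexponential_def by auto
  have sum: "g x = (\<Sum>i<n. h (x + real i * T))" for x
  proof -
    have "(\<Sum>i<n. h (x + real i * T))
        = (\<Sum>i<n. cdf N (x + real (Suc i) * T) - cdf N (x + real i * T))"
      by (simp add: h_def incr_def algebra_simps)
    also have "\<dots> = cdf N (x + real n * T) - cdf N x"
      by (subst sum_lessThan_telescope) simp
    finally show ?thesis using T by (simp add: g_def incr_def)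
  qed
  have "((\<lambda>x. \<Sum>i<n. h (x + real i * T) / h x) \<longlongrightarrow> (\<Sum>i<n. 1)) at_top"
    unfolding h_def by (intro tendsto_sum incr_shift T)
  then have "((\<lambda>x. inverse (g x / h x)) \<longlongrightarrow> inverse (real n)) at_top"
    using n by (intro tendsto_inverse) (simp_all add: sum sum_divide_distrib)
  then have "((\<lambda>x. h (x + s) / h x * inverse (g x / h x)) \<longlongrightarrow> 1 * inverse (real n)) at_top"
    using incr_shift[OF T(1)] unfolding h_def by (intro tendsto_mult)
  moreover have "\<forall>\<^sub>F x in at_top. h (x + s) / h x * inverse (g x / h x) = h (x + s) / g x"
    using h_pos by eventually_elim simp
  ultimately have "((\<lambda>x. h (x + s) / g x) \<longlongrightarrow> 1 * inverse (real n)) at_top"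
    by (rule Lim_transform_eventually)
  then show ?thesis by (simp add: h_def T_def inverse_eq_divide)
qed

lemma g_le_1: "g x \<le> 1"
  using incr_cdf_le[of 1] prob_space by (simp add: g_def)

text \<open>The almost-decrease hypothesis bounds g to the right of x - K - 1 by a multiple of g (x
  - K - 1); its real supremum is meaningful since g \<le> 1. Long-tailedness replaces that value by
  2 * g x. The result is the majorant for dominated convergence.\<close>

lemma g_dominated: "\<exists>C\<ge>0. \<forall>\<^sub>F x in at_top. \<forall>w\<ge>x - K. g w \<le> C * g x"
proof -
  obtain L x0 where L: "\<And>x. x \<ge> x0 \<Longrightarrow> (SUP y\<in>{x<..}. g y) \<le> L * g x"
    using almost_decreasing by auto
  have L': "g y \<le> L * g x" if "x \<ge> x0" "y > x" for x y
  proof -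
    have "g y \<le> (SUP y\<in>{x<..}. g y)"
      using that g_le_1 by (intro cSUP_upper bdd_aboveI2[where M = 1]) auto
    then show ?thesis using L[OF that(1)] by simp
  qed
  have "\<forall>\<^sub>F x in at_top. g (x + (- K - 1)) / g x < 2"
    by (rule order_tendstoD[OF g_shift]) simp
  then have "\<forall>\<^sub>F x in at_top. \<forall>w\<ge>x - K. g w \<le> \<bar>L\<bar> * 2 * g x"
    using g_pos eventually_ge_at_top[of "x0 + K + 1"]
  proof eventually_elim
    case (elim x)
    show ?case
    proof (intro allI impI)
      fix w assume "w \<ge> x - K"
      then have "g w \<le> L * g (x + (- K - 1))"
        using elim by (intro L') auto
      also have "\<dots> \<le> \<bar>L\<bar> * (2 * g x)"
        using elim g_nonneg by (intro mult_mono) (auto simp: divide_simps split: if_splits)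
      finally show "g w \<le> \<bar>L\<bar> * 2 * g x" by simp
    qed
  qed
  then show ?thesis by (intro exI[of _ "\<bar>L\<bar> * 2"]) auto
qed

text \<open>Eventually a unit step costs at most the factor exp (- \<delta>). Uniformity in t covers
  all starting points in [x1, x1 + 1], from which unit steps reach every x \<ge> x1.\<close>

lemma g_lower_bound:
  assumes "\<delta> > 0"
  shows "\<exists>c>0. \<exists>x1. \<forall>x\<ge>x1. g x \<ge> c * exp (- \<delta> * x)"
proof -
  have "delta_long_tailed 1 (cdf N)"
    using loc_subexp by (simp add: locally_subexponential_def delta_subexponential_def)
  then have "\<forall>\<^sub>F x in at_top. \<forall>t\<in>{0..1}. dist (g (x + t) / g x) 1 < 1 - exp (- \<delta>)"
    unfolding delta_long_tailed_def g_def using assms by (intro uniform_limitD) auto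
  then have "\<forall>\<^sub>F x in at_top. g x > 0 \<and> (\<forall>t\<in>{0..1}. g (x + t) \<ge> exp (- \<delta>) * g x)"
    using g_pos
  proof eventually_elim
    case (elim x)
    then show ?case
      by (force simp: dist_real_def abs_less_iff field_simps)
  qed
  then obtain x1 where pos: "\<And>x. x \<ge> x1 \<Longrightarrow> g x > 0"
    and step: "\<And>x t. x \<ge> x1 \<Longrightarrow> t \<in> {0..1} \<Longrightarrow> g (x + t) \<ge> exp (- \<delta>) * g x"
    unfolding eventually_at_top_linorder by blast
  have iter: "g (x1 + t + real n) \<ge> exp (- \<delta>) * g x1 * exp (- \<delta> * real n)" if "t \<in> {0..1}" for n t
  proof (induction n)
    case 0
    then show ?case using step[of x1] that by simp
  next
    case (Suc n)
    have "exp (- \<delta>) * g x1 * exp (- \<delta> * real (Suc n))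
        = exp (- \<delta>) * (exp (- \<delta>) * g x1 * exp (- \<delta> * real n))"
      by (simp add: algebra_simps flip: exp_add)
    also have "\<dots> \<le> exp (- \<delta>) * g (x1 + t + real n)"
      using Suc by (intro mult_left_mono) auto
    also have "\<dots> \<le> g (x1 + t + real n + 1)"
      using that by (intro step) auto
    finally show ?case by (simp add: algebra_simps)
  qed
  have "g x \<ge> exp (- \<delta>) * g x1 * exp (\<delta> * x1) * exp (- \<delta> * x)" if "x \<ge> x1" for x
  proof -
    define n where "n = nat \<lfloor>x - x1\<rfloor>"
    define t where "t = x - x1 - real n"
    have t: "t \<in> {0..1}" and x: "x = x1 + t + real n"
      using that by (auto simp: t_def n_def) linarith+
    have "exp (- \<delta>) * g x1 * (exp (\<delta> * x1) * exp (- \<delta> * x))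
        \<le> exp (- \<delta>) * g x1 * exp (- \<delta> * real n)"
      using pos[of x1] t assms by (intro mult_left_mono) (auto simp: x algebra_simps simp flip: exp_add)
    also have "\<dots> \<le> g x"
      using iter[OF t] by (simp add: x)
    finally show ?thesis by (simp add: mult.assoc)
  qed
  then show ?thesis
    using pos[of x1]
    by (intro exI[of _ "exp (- \<delta>) * g x1 * exp (\<delta> * x1)"] conjI exI[of _ x1]) auto
qed

lemma exp_neg_negligible:
  assumes "\<delta> > 0" "\<epsilon> > 0" "C \<ge> 0"
  shows "\<forall>\<^sub>F x in at_top. C * exp (- \<delta> * x) \<le> \<epsilon> * g x"
proof -
  \<comment> \<open>Half of the rate is spent on the lower bound; the other half tends to 0 and
    absorbs the constants.\<close>
  obtain c x1 where c: "c > 0" and lb: "\<And>x. x \<ge> x1 \<Longrightarrow> g x \<ge> c * exp (- (\<delta> / 2) * x)"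
    using g_lower_bound[of "\<delta> / 2"] assms by auto
  have "((\<lambda>x. exp (- (\<delta> / 2) * x)) \<longlongrightarrow> 0) at_top"
    using assms by (intro filterlim_compose[OF exp_at_bot]
      filterlim_tendsto_neg_mult_at_bot[OF tendsto_const _ filterlim_ident]) auto
  then have "((\<lambda>x. C * exp (- (\<delta> / 2) * x)) \<longlongrightarrow> C * 0) at_top"
    by (rule tendsto_mult_left)
  then have "\<forall>\<^sub>F x in at_top. C * exp (- (\<delta> / 2) * x) < \<epsilon> * c"
    using assms c by (intro order_tendstoD(2)) auto
  then show ?thesis
    using eventually_ge_at_top[of x1]
  proof eventually_elim
    case (elim x)
    have "C * exp (- \<delta> * x) = (C * exp (- (\<delta> / 2) * x)) * exp (- (\<delta> / 2) * x)"
      by (simp add: mult.assoc field_simps flip: exp_add)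
    also have "\<dots> \<le> (\<epsilon> * c) * exp (- (\<delta> / 2) * x)"
      using elim by (intro mult_right_mono) auto
    also have "\<dots> \<le> \<epsilon> * g x"
      using lb[OF elim(2)] assms by (simp add: mult.assoc mult_left_mono)
    finally show ?case .
  qed
qed

text \<open>Dominated convergence in z: each window ratio tends to T, and z \<le> K keeps x - z
  above x - K, where \<open>g_dominated\<close> supplies a constant majorant. Without the cut, z
  near x would bring in the bulk of N.\<close>

lemma truncated_convolution_asymp:
  assumes Q: "finite_borel_measure Q" and n: "n > 0"
  defines "T \<equiv> 1 / real n"
  shows "((\<lambda>x. (\<integral>z. indicator {..K} z * measure N {x - z<..x - z + T} \<partial>Q) / g x)
    \<longlongrightarrow> T * cdf Q K) at_top"
proof -
  interpret Q: finite_borel_measure Q by fact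
  note [measurable_cong] = Q.M_is_borel
  have T: "0 < T" "T \<le> 1" using n by (auto simp: T_def)
  obtain C where C: "C \<ge> 0" and dom: "\<forall>\<^sub>F x in at_top. \<forall>w\<ge>x - K. g w \<le> C * g x"
    using g_dominated by blast
  let ?s = "\<lambda>x z. indicator {..K} z * incr (cdf N) T (x - z) / g x"
  have "((\<lambda>x. \<integral>z. ?s x z \<partial>Q) \<longlongrightarrow> (\<integral>z. indicator {..K} z * T \<partial>Q)) at_top"
  proof (rule integral_dominated_convergence_at_top)
    show "(\<lambda>z. indicator {..K} z * T) \<in> borel_measurable Q" by measurable
    show "?s x \<in> borel_measurable Q" for x by measurable
    show "integrable Q (\<lambda>_. C)" by simp
    show "AE z in Q. ((\<lambda>x. ?s x z) \<longlongrightarrow> indicator {..K} z * T) at_top"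
    proof (intro AE_I2)
      fix z
      have "((\<lambda>x. indicator {..K} z * (incr (cdf N) T (x + - z) / g x)) \<longlongrightarrow> indicator {..K} z * T) at_top"
        unfolding T_def by (intro tendsto_mult_left incr_window_ratio n)
      then show "((\<lambda>x. ?s x z) \<longlongrightarrow> indicator {..K} z * T) at_top" by simp
    qed
    show "\<forall>\<^sub>F x in at_top. AE z in Q. norm (?s x z) \<le> C"
      using dom g_pos
    proof eventually_elim
      case (elim x)
      have "norm (?s x z) \<le> C" for z
      proof (cases "z \<le> K")
        case True
        have "incr (cdf N) T (x - z) \<le> g (x - z)"
          unfolding g_def incr_def using T by (simp add: cdf_nondecreasing)
        also have "\<dots> \<le> C * g x"
          using elim True by simp
        finally show ?thesis
          using elim True T by (simp add: incr_cdf_nonneg divide_simps)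
      qed (use C in simp)
      then show ?case by simp
    qed
  qed
  then show ?thesis
    using T by (simp add: incr_cdf cdf_def2[symmetric] Q.borel_UNIV mult.commute)
qed

text \<open>A single large jump of \<open>N\<close> sees \<open>Q\<close> only through its total mass.\<close>

lemma bounded_part_asymp:
  assumes Q: "finite_borel_measure Q" and n: "n > 0" and eps: "\<epsilon> > 0"
  defines "T \<equiv> 1 / real n"
  shows "\<exists>K0. \<forall>K\<ge>K0. \<forall>\<^sub>F x in at_top.
    \<bar>(\<integral>y. indicator {..K} (x - y) * incr (cdf Q) T (x - y) \<partial>N) - T * measure Q UNIV * g x\<bar> \<le> \<epsilon> * g x"
proof -
  interpret Q: finite_borel_measure Q by fact
  have T: "T > 0" using n by (simp add: T_def)
  let ?q = "measure Q UNIV"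
  have "((\<lambda>K. T * cdf Q K) \<longlongrightarrow> T * ?q) at_top"
    using Q.cdf_lim_at_top by (intro tendsto_mult_left) (simp add: Q.borel_UNIV)
  then have "\<forall>\<^sub>F K in at_top. T * cdf Q K > T * ?q - \<epsilon>"
    using eps by (intro order_tendstoD(1)) auto
  then obtain K0 where K0: "\<And>K. K \<ge> K0 \<Longrightarrow> T * cdf Q K > T * ?q - \<epsilon>"
    unfolding eventually_at_top_linorder by blast
  have "\<forall>\<^sub>F x in at_top.
    \<bar>(\<integral>y. indicator {..K} (x - y) * incr (cdf Q) T (x - y) \<partial>N) - T * ?q * g x\<bar> \<le> \<epsilon> * g x"
    if "K \<ge> K0" for K
  proof -
    define W where "W K x = (\<integral>z. indicator {..K} z * measure N {x - z<..x - z + T} \<partial>Q)" for K x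
    define D where "D x = (\<integral>y. indicator {..K} (x - y) * incr (cdf Q) T (x - y) \<partial>N)" for x
    note swap = convolution_window_swap[OF finite_borel_measure_M Q, of _ _ T]
    have int: "integrable N (\<lambda>y. indicator {..K} (x - y) * incr (cdf Q) T (x - y))" for x
      using Q.incr_cdf_nonneg[OF T] Q.incr_cdf_le[OF T]
      by (intro integrable_const_bound[where B = ?q]) (auto split: split_indicator)
    \<comment> \<open>The integrand cuts the left end x - y of the window at K, whereas
      \<open>convolution_window_swap\<close> cuts the points of Q. The cuts differ by at most the
      window length, hence the sandwich between the levels K and K + T.\<close>
    have lo: "W K x \<le> D x" for x
      unfolding W_def D_def swap(2)
    proof (intro integral_mono swap(1) int)
      fix y
      show "measure Q ({..K} \<inter> {x - y<..x - y + T}) \<le> indicator {..K} (x - y) * incr (cdf Q) T (x - y)"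
      proof (cases "x - y \<le> K")
        case True
        then show ?thesis
          using T by (auto simp: Q.incr_cdf intro!: Q.finite_measure_mono)
      next
        case False
        then have "{..K} \<inter> {x - y<..x - y + T} = {}" by auto
        then show ?thesis
          using False by simp
      qed
    qed
    have hi: "D x \<le> W (K + T) x" for x
      unfolding W_def D_def swap(2)
    proof (intro integral_mono swap(1) int)
      fix y
      show "indicator {..K} (x - y) * incr (cdf Q) T (x - y) \<le> measure Q ({..K + T} \<inter> {x - y<..x - y + T})"
        using T by (auto simp: Q.incr_cdf intro!: Q.finite_measure_mono split: split_indicator)
    qed
    have limit: "((\<lambda>x. W K x / g x) \<longlongrightarrow> T * cdf Q K) at_top" for K
      unfolding W_def T_def by (rule truncated_convolution_asymp[OF Q n])
    have "\<forall>\<^sub>F x in at_top. W K x / g x > T * ?q - \<epsilon>"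
      by (rule order_tendstoD(1)[OF limit K0[OF that]])
    moreover have "T * cdf Q (K + T) < T * ?q + \<epsilon>"
      using Q.cdf_bounded[of "K + T"] T eps mult_left_mono[of "cdf Q (K + T)" ?q T]
      unfolding Q.borel_UNIV by linarith
    then have "\<forall>\<^sub>F x in at_top. W (K + T) x / g x < T * ?q + \<epsilon>"
      by (rule order_tendstoD(2)[OF limit])
    ultimately show ?thesis
      using g_pos
    proof eventually_elim
      case (elim x)
      then show ?case
        using lo[of x] hi[of x] unfolding D_def[symmetric] by (simp add: field_simps abs_le_iff)
    qed
  qed
  then show ?thesis by blast
qed

lemma convolution_incr:
  "incr (df_convolution (cdf N) (cdf N)) 1 x = (\<integral>y. g (x - y) \<partial>N)"
proof -
  note [measurable_cong] = M_is_borel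
  have N: "interval_measure (cdf N) = N"
    by (intro cdf_unique real_distribution_interval_measure cdf_interval_measure
        cdf_nondecreasing cdf_is_right_cont cdf_lim_at_bot cdf_lim_at_top_prob real_distribution_axioms)
  have fin: "finite_measure (N \<star> N)"
    by (rule convolution_finite) (simp_all add: finite_measure_axioms)
  then interpret NN: finite_borel_measure "N \<star> N"
    by (simp add: finite_borel_measure_def finite_borel_measure_axioms_def)
  have "emeasure (N \<star> N) {x<..x + 1} = (\<integral>\<^sup>+y. emeasure N {a. a + y \<in> {x<..x + 1}} \<partial>N)"
    by (rule convolution_emeasure) (simp_all add: finite_measure_axioms)
  also have "\<dots> = (\<integral>\<^sup>+y. ennreal (g (x - y)) \<partial>N)"
  proof (intro nn_integral_cong)
    fix y
    have "{a. a + y \<in> {x<..x + 1}} = {x - y<..x - y + 1}" by auto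
    then show "emeasure N {a. a + y \<in> {x<..x + 1}} = ennreal (g (x - y))"
      by (simp add: g_def incr_cdf emeasure_eq_measure)
  qed
  also have "\<dots> = ennreal (\<integral>y. g (x - y) \<partial>N)"
    using g_nonneg g_le_1
    by (intro nn_integral_eq_integral integrable_const_bound[where B = 1]) (auto simp: g_def)
  finally have "measure (N \<star> N) {x<..x + 1} = (\<integral>y. g (x - y) \<partial>N)"
    by (simp add: measure_def g_nonneg)
  then show ?thesis
    by (simp add: df_convolution_def N NN.incr_cdf)
qed

text \<open>By subexponentiality the full convolution of N with g is asymptotic to 2 * g.
  \<open>bounded_part_asymp\<close> with Q = N, of mass 1, and the unit window accounts for one g;
  the part with x - y > K keeps the other.\<close>

lemma large_part_asymp:
  assumes eps: "\<epsilon> > 0"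
  shows "\<exists>K0. \<forall>K\<ge>K0. \<forall>\<^sub>F x in at_top.
    \<bar>(\<integral>y. indicator {K<..} (x - y) * g (x - y) \<partial>N) - g x\<bar> \<le> \<epsilon> * g x"
proof -
  note [measurable_cong] = M_is_borel
  have [measurable]: "g \<in> borel_measurable borel" by (simp add: g_def)
  have "\<exists>K0. \<forall>K\<ge>K0. \<forall>\<^sub>F x in at_top.
      \<bar>(\<integral>y. indicator {..K} (x - y) * g (x - y) \<partial>N) - g x\<bar> \<le> \<epsilon> / 2 * g x"
    using bounded_part_asymp[OF finite_borel_measure_M, of 1 "\<epsilon> / 2"] eps prob_space
    by (simp add: g_def)
  then obtain K0 where K0: "\<And>K. K \<ge> K0 \<Longrightarrow> \<forall>\<^sub>F x in at_top.
      \<bar>(\<integral>y. indicator {..K} (x - y) * g (x - y) \<partial>N) - g x\<bar> \<le> \<epsilon> / 2 * g x" by blast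
  have "(\<lambda>x. incr (df_convolution (cdf N) (cdf N)) 1 x) \<sim>[at_top] (\<lambda>x. 2 * g x)"
    using loc_subexp unfolding locally_subexponential_def delta_subexponential_def g_def by auto
  then have "(\<lambda>x. \<integral>y. g (x - y) \<partial>N) \<sim>[at_top] (\<lambda>x. 2 * g x)"
    unfolding convolution_incr .
  then have "((\<lambda>x. (\<integral>y. g (x - y) \<partial>N) / (2 * g x)) \<longlongrightarrow> 1) at_top"
    using g_pos by (intro asymp_equivD_strong) (auto elim: eventually_mono)
  then have "\<forall>\<^sub>F x in at_top. dist ((\<integral>y. g (x - y) \<partial>N) / (2 * g x)) 1 < \<epsilon> / 4"
    using eps by (intro tendstoD) auto
  then have total: "\<forall>\<^sub>F x in at_top. \<bar>(\<integral>y. g (x - y) \<partial>N) - 2 * g x\<bar> \<le> \<epsilon> / 2 * g x"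
    using g_pos
  proof eventually_elim
    case (elim x)
    then show ?case by (simp add: dist_real_def abs_le_iff abs_less_iff field_simps)
  qed
  have "\<forall>\<^sub>F x in at_top. \<bar>(\<integral>y. indicator {K<..} (x - y) * g (x - y) \<partial>N) - g x\<bar> \<le> \<epsilon> * g x"
    if "K \<ge> K0" for K
    using K0[OF that] total
  proof eventually_elim
    case (elim x)
    have int: "integrable N (\<lambda>y. indicator S (x - y) * g (x - y))" if [measurable]: "S \<in> sets borel" for S
      using g_nonneg g_le_1 by (intro integrable_const_bound[where B = 1]) (auto split: split_indicator)
    have "(\<integral>y. g (x - y) \<partial>N)
        = (\<integral>y. indicator {..K} (x - y) * g (x - y) + indicator {K<..} (x - y) * g (x - y) \<partial>N)"
      by (intro Bochner_Integration.integral_cong) (auto split: split_indicator)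
    also have "\<dots> = (\<integral>y. indicator {..K} (x - y) * g (x - y) \<partial>N)
        + (\<integral>y. indicator {K<..} (x - y) * g (x - y) \<partial>N)"
      by (intro Bochner_Integration.integral_add int) auto
    finally show ?case
      using elim by linarith
  qed
  then show ?thesis by blast
qed

end

section \<open>The windowed renewal equation as a contraction\<close>

locale window_renewal = locally_subexponential_law N g + Q: finite_borel_measure Q
  for N :: "real measure" and g :: "real \<Rightarrow> real" and Q :: "real measure" +
  fixes n :: nat and \<theta> :: real and T :: real and u :: "real \<Rightarrow> real"
  defines "T \<equiv> 1 / real n" and "u \<equiv> incr (cdf Q) T"
  assumes n: "n > 0" and \<theta>: "0 \<le> \<theta>" "\<theta> < 1"
    and renewal: "\<And>\<epsilon>. \<epsilon> > 0 \<Longrightarrow> \<forall>\<^sub>F x in at_top. \<bar>u x - \<theta> * (\<integral>y. u (x - y) \<partial>N)\<bar> \<le> \<epsilon> * g x"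
begin

lemma T_pos: "T > 0"
  using n by (simp add: T_def)

lemma u_nonneg: "u x \<ge> 0"
  using T_pos by (simp add: u_def Q.incr_cdf_nonneg)

lemma u_le: "u x \<le> measure Q UNIV"
  using T_pos by (simp add: u_def Q.incr_cdf_le)

lemma integrable_cut:
  assumes [measurable]: "S \<in> sets borel" "h \<in> borel_measurable borel"
    and bound: "\<And>x. \<bar>h x\<bar> \<le> C"
  shows "integrable N (\<lambda>y. indicator S (x - y) * h (x - y) :: real)"
proof -
  note [measurable_cong] = M_is_borel
  have "C \<ge> 0" using bound[of 0] by linarith
  then show ?thesis
    using bound by (intro integrable_const_bound[where B = C]) (auto split: split_indicator)
qed

lemma integrable_cut_u: "S \<in> sets borel \<Longrightarrow> integrable N (\<lambda>y. indicator S (x - y) * u (x - y))"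
  using u_nonneg u_le by (intro integrable_cut[where C = "measure Q UNIV"]) (auto simp: u_def)

lemma integrable_cut_g: "S \<in> sets borel \<Longrightarrow> integrable N (\<lambda>y. indicator S (x - y) * g (x - y))"
  using g_nonneg g_le_1 by (intro integrable_cut[where C = 1]) (auto simp: g_def)

lemma integrable_cut_const: "S \<in> sets borel \<Longrightarrow> integrable N (\<lambda>y. indicator S (x - y) * c)"
  for c :: real
  by (intro integrable_cut[where h = "\<lambda>_. c" and C = "\<bar>c\<bar>"]) auto

lemma convolution_split:
  "(\<integral>y. u (x - y) \<partial>N) = (\<integral>y. indicator {..K} (x - y) * u (x - y) \<partial>N)
     + (\<integral>y. indicator {K<..} (x - y) * u (x - y) \<partial>N)"
proof -
  have "(\<integral>y. u (x - y) \<partial>N)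
      = (\<integral>y. indicator {..K} (x - y) * u (x - y) + indicator {K<..} (x - y) * u (x - y) \<partial>N)"
    by (intro Bochner_Integration.integral_cong) (auto split: split_indicator)
  then show ?thesis
    by (simp add: Bochner_Integration.integral_add integrable_cut_u)
qed

text \<open>
  Finiteness of \<open>sup u / g\<close> is obtained for the regularised quotient \<open>u / (g + \<epsilon>)\<close>, which is
  trivially bounded; the bound does not depend on \<open>\<epsilon>\<close> since constants, too, are contracted
  by \<open>\<theta>\<close> times the convolution with \<open>N\<close>.
\<close>

lemma u_dominated: "\<exists>C\<ge>0. \<forall>\<^sub>F x in at_top. u x \<le> C * g x"
proof -
  define q where "q = measure Q UNIV"
  have q: "q \<ge> 0" by (simp add: q_def)
  define \<eta> where "\<eta> = (1 - \<theta>) / 2"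
  define \<rho> where "\<rho> = \<theta> * (1 + \<eta>)"
  have \<eta>: "\<eta> > 0" using \<theta> by (simp add: \<eta>_def)
  have "1 - \<rho> = (1 - \<theta>) * (1 - \<theta> / 2)"
    by (simp add: \<rho>_def \<eta>_def field_simps)
  moreover have "\<dots> > 0" using \<theta> by (intro mult_pos_pos) auto
  ultimately have "\<rho> < 1" by linarith
  moreover have "\<rho> \<ge> 0" using \<theta> \<eta> by (simp add: \<rho>_def)
  ultimately have \<rho>: "0 \<le> \<rho>" "\<rho> < 1" by auto
  obtain K0 where K0: "\<And>K. K \<ge> K0 \<Longrightarrow> \<forall>\<^sub>F x in at_top.
      \<bar>(\<integral>y. indicator {..K} (x - y) * u (x - y) \<partial>N) - T * q * g x\<bar> \<le> 1 * g x"
    using bounded_part_asymp[OF Q.finite_borel_measure_axioms n, of 1]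
    unfolding u_def T_def q_def by auto
  obtain K1 where K1: "\<And>K. K \<ge> K1 \<Longrightarrow> \<forall>\<^sub>F x in at_top.
      \<bar>(\<integral>y. indicator {K<..} (x - y) * g (x - y) \<partial>N) - g x\<bar> \<le> \<eta> * g x"
    using large_part_asymp[OF \<eta>] by auto
  obtain c x1 where c: "c > 0" and lower: "\<And>x. x \<ge> x1 \<Longrightarrow> g x \<ge> c * exp (- 1 * x)"
    using g_lower_bound[of 1] by auto
  \<comment> \<open>One level serves twice: it cuts the integral, and the bound is claimed from it
    onward, so the induction hypothesis applies exactly where x - y > K. Being at least x1, it also
    makes \<open>lower\<close> available on this range.\<close>
  define K where "K = max x1 (max K0 K1)"
  have K: "K \<ge> x1" "K \<ge> K0" "K \<ge> K1" by (auto simp: K_def)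
  have "\<forall>\<^sub>F x in at_top. u x \<le> g x + \<theta> * ((T * q + 1) * g x
      + (\<integral>y. indicator {K<..} (x - y) * u (x - y) \<partial>N))
      \<and> (\<integral>y. indicator {K<..} (x - y) * g (x - y) \<partial>N) \<le> (1 + \<eta>) * g x"
    using K0[OF K(2)] K1[OF K(3)] renewal[of 1, simplified]
  proof eventually_elim
    case (elim x)
    have "\<theta> * (\<integral>y. u (x - y) \<partial>N) \<le> \<theta> * ((T * q + 1) * g x
      + (\<integral>y. indicator {K<..} (x - y) * u (x - y) \<partial>N))"
      using elim(1) \<theta>(1) unfolding convolution_split[of x K]
      by (intro mult_left_mono) (auto simp: algebra_simps)
    then show ?case
      using elim(2,3) by (auto simp: algebra_simps)
  qed
  then obtain x2 where x2: "\<And>x. x \<ge> x2 \<Longrightarrow> u x \<le> g x + \<theta> * ((T * q + 1) * g x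
      + (\<integral>y. indicator {K<..} (x - y) * u (x - y) \<partial>N))"
    and J: "\<And>x. x \<ge> x2 \<Longrightarrow> (\<integral>y. indicator {K<..} (x - y) * g (x - y) \<partial>N) \<le> (1 + \<eta>) * g x"
    unfolding eventually_at_top_linorder by blast
  \<comment> \<open>Between K and x2 the asymptotic estimates say nothing; there u \<le> q while g
    \<ge> m, so the term q / m in C settles this range.\<close>
  define m where "m = c * exp (- x2)"
  have m: "m > 0" using c by (simp add: m_def)
  define C where "C = max (q / m) (1 + \<theta> * (T * q + 1))"
  have C: "C \<ge> 0" "C \<ge> q / m" "C \<ge> 1 + \<theta> * (T * q + 1)"
    using q m by (auto simp: C_def le_max_iff_disj)
  have step: "\<forall>x\<ge>K. u x \<le> (\<rho> * \<beta> + C) * (g x + \<epsilon>)"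
    if \<beta>: "\<beta> \<ge> 0" and eps: "\<epsilon> > 0" and IH: "\<forall>x\<ge>K. u x \<le> \<beta> * (g x + \<epsilon>)" for \<beta> \<epsilon>
  proof (intro allI impI)
    fix x assume xK: "x \<ge> K"
    show "u x \<le> (\<rho> * \<beta> + C) * (g x + \<epsilon>)"
    proof (cases "x \<ge> x2")
      case True
      have "(\<integral>y. indicator {K<..} (x - y) * u (x - y) \<partial>N)
          \<le> (\<integral>y. \<beta> * (indicator {K<..} (x - y) * g (x - y) + indicator {K<..} (x - y) * \<epsilon>) \<partial>N)"
        using IH by (intro integral_mono integrable_cut_u Bochner_Integration.integrable_mult_right
            Bochner_Integration.integrable_add integrable_cut_g integrable_cut_const)
          (auto split: split_indicator)
      also have "\<dots> = \<beta> * ((\<integral>y. indicator {K<..} (x - y) * g (x - y) \<partial>N)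
          + (\<integral>y. indicator {K<..} (x - y) * \<epsilon> \<partial>N))"
        unfolding Bochner_Integration.integral_mult_right_zero
        by (subst Bochner_Integration.integral_add)
           (intro integrable_cut_g integrable_cut_const refl; simp)+
      also have "\<dots> \<le> \<beta> * ((1 + \<eta>) * g x + (\<integral>y. \<epsilon> \<partial>N))"
        using \<beta> eps J[OF True]
        by (intro mult_left_mono add_mono integral_mono integrable_cut_const) (auto split: split_indicator)
      also have "\<dots> \<le> \<beta> * ((1 + \<eta>) * (g x + \<epsilon>))"
        using \<beta> eps \<eta> prob_space by (intro mult_left_mono) (auto simp: algebra_simps)
      finally have "u x \<le> g x + \<theta> * ((T * q + 1) * g x + \<beta> * ((1 + \<eta>) * (g x + \<epsilon>)))"
        using \<theta> by (intro order_trans[OF x2[OF True]] add_left_mono mult_left_mono) auto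
      also have "\<dots> = (1 + \<theta> * (T * q + 1)) * g x + \<rho> * \<beta> * (g x + \<epsilon>)"
        by (simp add: \<rho>_def algebra_simps)
      also have "\<dots> \<le> C * (g x + \<epsilon>) + \<rho> * \<beta> * (g x + \<epsilon>)"
        using C eps g_nonneg[of x] by (intro add_right_mono mult_mono) auto
      finally show ?thesis by (simp add: algebra_simps)
    next
      case False
      have "m \<le> c * exp (- 1 * x)"
        using False c by (simp add: m_def)
      also have "\<dots> \<le> g x" using lower xK K by simp
      finally have "C * m \<le> C * (g x + \<epsilon>)"
        using C eps by (intro mult_left_mono) auto
      moreover have "u x \<le> C * m"
        using u_le[of x] C(2) m by (simp add: q_def field_simps)
      moreover have "0 \<le> \<rho> * \<beta> * (g x + \<epsilon>)"
        using \<rho> \<beta> eps g_nonneg[of x] by simp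
      ultimately show ?thesis by (simp add: algebra_simps)
    qed
  qed
  have regularised: "u x \<le> (C / (1 - \<rho>) + 1) * (g x + \<epsilon>)" if eps: "\<epsilon> > 0" and "x \<ge> K" for x \<epsilon>
  proof -
    have "\<forall>x\<ge>K. u x \<le> (C / (1 - \<rho>) + 1) * (g x + \<epsilon>)"
    proof (rule affine_iteration_bound[where P = "\<lambda>\<beta>. \<forall>x\<ge>K. u x \<le> \<beta> * (g x + \<epsilon>)" and \<rho> = \<rho> and C = C])
      show "\<forall>x\<ge>K. u x \<le> q / \<epsilon> * (g x + \<epsilon>)"
      proof (intro allI impI)
        fix x
        have "u x \<le> q / \<epsilon> * \<epsilon>" using u_le[of x] eps by (simp add: q_def)
        also have "\<dots> \<le> q / \<epsilon> * (g x + \<epsilon>)"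
          using g_nonneg[of x] q eps by (intro mult_left_mono) auto
        finally show "u x \<le> q / \<epsilon> * (g x + \<epsilon>)" .
      qed
      show "\<forall>x\<ge>K. u x \<le> \<beta>' * (g x + \<epsilon>)"
        if "\<beta> \<le> \<beta>'" "\<forall>x\<ge>K. u x \<le> \<beta> * (g x + \<epsilon>)" for \<beta> \<beta>'
        using that g_nonneg eps by (meson add_nonneg_pos less_imp_le mult_right_mono order_trans)
    qed (use step eps q \<rho> C in auto)
    then show ?thesis using that by blast
  qed
  have "u x \<le> (C / (1 - \<rho>) + 1) * g x" if "x \<ge> K" for x
  proof (rule tendsto_lowerbound)
    show "((\<lambda>\<epsilon>. (C / (1 - \<rho>) + 1) * (g x + \<epsilon>)) \<longlongrightarrow> (C / (1 - \<rho>) + 1) * g x) (at_right 0)"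
      by (auto intro!: tendsto_eq_intros)
    show "\<forall>\<^sub>F \<epsilon> in at_right 0. u x \<le> (C / (1 - \<rho>) + 1) * (g x + \<epsilon>)"
      using regularised that by (auto simp: eventually_at_filter)
  qed simp
  moreover have "C / (1 - \<rho>) + 1 \<ge> 0" using C \<rho> by simp
  ultimately show ?thesis
    unfolding eventually_at_top_linorder by blast
qed

text \<open>The value c is the fixed point c = \<theta> * (T * q + c). After cutting at K, the piece
  x - y \<le> K contributes T * q * g x whatever \<beta> is, and the remote piece is c * J up to
  \<beta> * J with J close to g x. Only the latter carries the old error, and it is multiplied by
  \<theta>.\<close>

lemma contraction_step:
  defines "c \<equiv> \<theta> / (1 - \<theta>) * (T * measure Q UNIV)"
  assumes \<beta>: "\<beta> \<ge> 0" and close: "\<forall>\<^sub>F x in at_top. \<bar>u x - c * g x\<bar> \<le> \<beta> * g x" and \<eta>: "\<eta> > 0"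
  shows "\<forall>\<^sub>F x in at_top. \<bar>u x - c * g x\<bar> \<le> (\<theta> * \<beta> + \<eta>) * g x"
proof -
  define q where "q = measure Q UNIV"
  have c: "c \<ge> 0" "c = \<theta> * (T * q + c)"
    using \<theta> T_pos by (auto simp: c_def q_def field_simps)
  \<comment> \<open>Shares of the loss \<eta>: one \<epsilon> for the renewal equation, one for the
    bounded piece, and \<beta> + c of them for replacing J by g x.\<close>
  define \<epsilon> where "\<epsilon> = \<eta> / (2 + \<beta> + c)"
  have eps: "\<epsilon> > 0" "(2 + \<beta> + c) * \<epsilon> = \<eta>"
    using \<eta> \<beta> c by (auto simp: \<epsilon>_def)
  obtain K0 where K0: "\<And>K. K \<ge> K0 \<Longrightarrow> \<forall>\<^sub>F x in at_top.
      \<bar>(\<integral>y. indicator {..K} (x - y) * u (x - y) \<partial>N) - T * q * g x\<bar> \<le> \<epsilon> * g x"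
    using bounded_part_asymp[OF Q.finite_borel_measure_axioms n eps(1)]
    unfolding u_def T_def q_def by auto
  obtain K1 where K1: "\<And>K. K \<ge> K1 \<Longrightarrow> \<forall>\<^sub>F x in at_top.
      \<bar>(\<integral>y. indicator {K<..} (x - y) * g (x - y) \<partial>N) - g x\<bar> \<le> \<epsilon> * g x"
    using large_part_asymp[OF eps(1)] by auto
  obtain K2 where K2: "\<And>x. x \<ge> K2 \<Longrightarrow> \<bar>u x - c * g x\<bar> \<le> \<beta> * g x"
    using close unfolding eventually_at_top_linorder by auto
  define K where "K = max K2 (max K0 K1)"
  have K: "K \<ge> K2" "K \<ge> K0" "K \<ge> K1" by (auto simp: K_def)
  show ?thesis
    using K0[OF K(2)] K1[OF K(3)] renewal[OF eps(1)]
  proof eventually_elim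
    case (elim x)
    define P1 where "P1 = (\<integral>y. indicator {..K} (x - y) * u (x - y) \<partial>N)"
    define P2 where "P2 = (\<integral>y. indicator {K<..} (x - y) * u (x - y) \<partial>N)"
    define J where "J = (\<integral>y. indicator {K<..} (x - y) * g (x - y) \<partial>N)"
    have "P2 \<le> (\<integral>y. (c + \<beta>) * (indicator {K<..} (x - y) * g (x - y)) \<partial>N)"
      unfolding P2_def
    proof (intro integral_mono integrable_cut_u Bochner_Integration.integrable_mult_right integrable_cut_g)
      fix y
      show "indicator {K<..} (x - y) * u (x - y) \<le> (c + \<beta>) * (indicator {K<..} (x - y) * g (x - y))"
        using K2[of "x - y"] K by (auto simp: algebra_simps abs_le_iff split: split_indicator)
    qed auto
    then have up: "P2 \<le> (c + \<beta>) * J" by (simp add: J_def)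
    have "(\<integral>y. (c - \<beta>) * (indicator {K<..} (x - y) * g (x - y)) \<partial>N) \<le> P2"
      unfolding P2_def
    proof (intro integral_mono integrable_cut_u Bochner_Integration.integrable_mult_right integrable_cut_g)
      fix y
      show "(c - \<beta>) * (indicator {K<..} (x - y) * g (x - y)) \<le> indicator {K<..} (x - y) * u (x - y)"
        using K2[of "x - y"] K by (auto simp: algebra_simps abs_le_iff split: split_indicator)
    qed auto
    then have low: "(c - \<beta>) * J \<le> P2" by (simp add: J_def)
    have J: "\<bar>J - g x\<bar> \<le> \<epsilon> * g x" using elim(2) by (simp add: J_def)
    have P2: "\<bar>P2 - c * g x\<bar> \<le> \<beta> * g x + (\<beta> + c) * (\<epsilon> * g x)"
    proof -
      have "\<bar>P2 - c * J\<bar> \<le> \<beta> * J" using up low by (simp add: algebra_simps abs_le_iff)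
      moreover have "\<beta> * J \<le> \<beta> * (g x + \<epsilon> * g x)" using J \<beta> by (intro mult_left_mono) auto
      moreover have "\<bar>c * J - c * g x\<bar> \<le> c * (\<epsilon> * g x)"
        using J c(1) mult_left_mono[OF J c(1)] by (simp add: abs_mult flip: right_diff_distrib)
      ultimately show ?thesis by (simp add: algebra_simps abs_le_iff)
    qed
    have P1: "\<bar>P1 - T * q * g x\<bar> \<le> \<epsilon> * g x" using elim(1) by (simp add: P1_def)
    have "\<bar>u x - \<theta> * (P1 + P2)\<bar> \<le> \<epsilon> * g x"
      using elim(3) by (simp add: convolution_split[of x K] P1_def P2_def)
    moreover have "\<bar>\<theta> * (P1 + P2) - c * g x\<bar> \<le> \<theta> * (\<epsilon> * g x + (\<beta> * g x + (\<beta> + c) * (\<epsilon> * g x)))"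
    proof -
      have "\<theta> * (P1 + P2) - c * g x = \<theta> * (P1 + P2 - (T * q + c) * g x)"
        using c(2) by (metis mult.assoc right_diff_distrib)
      moreover have "\<bar>P1 + P2 - (T * q + c) * g x\<bar> \<le> \<epsilon> * g x + (\<beta> * g x + (\<beta> + c) * (\<epsilon> * g x))"
        using P1 P2 by (simp add: algebra_simps abs_le_iff)
      ultimately show ?thesis
        using \<theta> by (simp add: abs_mult mult_left_mono)
    qed
    moreover have "\<theta> * (\<epsilon> * g x + (\<beta> + c) * (\<epsilon> * g x)) \<le> 1 * (\<epsilon> * g x + (\<beta> + c) * (\<epsilon> * g x))"
      using \<theta> eps \<beta> c(1) g_nonneg[of x] by (intro mult_right_mono) auto
    moreover have "(\<theta> * \<beta> + \<eta>) * g x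
        = \<epsilon> * g x + \<theta> * (\<beta> * g x) + (\<epsilon> * g x + (\<beta> + c) * (\<epsilon> * g x))"
      unfolding eps(2)[symmetric] by (simp add: algebra_simps)
    ultimately show ?case by (simp add: algebra_simps abs_le_iff)
  qed
qed

theorem window_asymp: "((\<lambda>x. u x / g x) \<longlongrightarrow> \<theta> / (1 - \<theta>) * (T * measure Q UNIV)) at_top"
proof (rule tendstoI)
  fix \<epsilon> :: real assume eps: "\<epsilon> > 0"
  define c where "c = \<theta> / (1 - \<theta>) * (T * measure Q UNIV)"
  have c: "c \<ge> 0" using \<theta> T_pos by (simp add: c_def)
  define P where "P \<beta> \<longleftrightarrow> (\<forall>\<^sub>F x in at_top. \<bar>u x - c * g x\<bar> \<le> \<beta> * g x)" for \<beta>
  obtain C where C: "C \<ge> 0" and dom: "\<forall>\<^sub>F x in at_top. u x \<le> C * g x"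
    using u_dominated by blast
  \<comment> \<open>\<open>u_dominated\<close> makes the start C + c available. A loss of \<epsilon>
    * (1 - \<theta>) / 4 per step accumulates to the fixed point \<epsilon> / 4, below \<epsilon> /
    2.\<close>
  have "P (\<epsilon> / 2)"
  proof (rule affine_iteration_bound[where P = P and \<rho> = \<theta> and C = "\<epsilon> * (1 - \<theta>) / 4"])
    show "P (C + c)"
      unfolding P_def using dom
    proof eventually_elim
      case (elim x)
      have "0 \<le> c * g x" "0 \<le> C * g x" using c C g_nonneg[of x] by auto
      then show ?case using elim u_nonneg[of x] by (simp add: algebra_simps abs_le_iff)
    qed
    show "P \<beta>'" if "\<beta> \<le> \<beta>'" "P \<beta>" for \<beta> \<beta>'
      using that(2) unfolding P_def
    proof eventually_elim
      case (elim x)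
      then show ?case using mult_right_mono[OF that(1) g_nonneg[of x]] by linarith
    qed
    show "P (\<theta> * \<beta> + \<epsilon> * (1 - \<theta>) / 4)" if "\<beta> \<ge> 0" "P \<beta>" for \<beta>
      using contraction_step[OF that(1)] that(2) eps \<theta> unfolding P_def c_def by simp
    show "\<epsilon> * (1 - \<theta>) / 4 / (1 - \<theta>) < \<epsilon> / 2"
      using \<theta> eps by (simp add: field_simps)
  qed (use C c \<theta> eps in auto)
  then show "\<forall>\<^sub>F x in at_top. dist (u x / g x) (\<theta> / (1 - \<theta>) * (T * measure Q UNIV)) < \<epsilon>"
    unfolding P_def c_def[symmetric] using g_pos
  proof eventually_elim
    case (elim x)
    have "\<bar>u x / g x - c\<bar> = \<bar>u x - c * g x\<bar> / g x"
      using elim by (simp add: abs_if field_simps)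
    also have "\<dots> \<le> \<epsilon> / 2" using elim by (simp add: field_simps)
    finally show ?case using eps by (simp add: dist_real_def)
  qed
qed

end

section \<open>Moments of the solution\<close>

locale perpetuity =
  pair_prob_space M \<mu> for M :: "'a measure" and \<mu> :: "real measure" +
  fixes A B :: "'a \<Rightarrow> real" and \<kappa> \<nu> \<theta> :: real
  assumes A_measurable [measurable]: "A \<in> borel_measurable M"
    and B_measurable [measurable]: "B \<in> borel_measurable M"
    and A_nonneg: "AE \<omega> in M. A \<omega> \<ge> 0"
    and \<kappa>_pos: "\<kappa> > 0"
    and A_moment: "integrable M (\<lambda>\<omega>. A \<omega> powr \<kappa>)"
    and \<theta>_def: "\<theta> = moment M A \<kappa>" and \<theta>: "0 < \<theta>" "\<theta> < 1"
    and \<nu>: "\<nu> > \<kappa>"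
    and B_moment: "integrable M (\<lambda>\<omega>. \<bar>B \<omega>\<bar> powr \<nu>)"
    and solution: "perpetuity_solution M A B \<mu>"
begin

abbreviation joint :: "('a \<times> real) measure" where
  "joint \<equiv> M \<Otimes>\<^sub>M \<mu>"

lemma sets_\<mu> [measurable_cong]: "sets \<mu> = sets borel"
  using solution by (simp add: perpetuity_solution_def real_distribution_def real_distribution_axioms_def)

lemma space_\<mu> [simp]: "space \<mu> = UNIV"
  using sets_eq_imp_space_eq[OF sets_\<mu>] by simp

lemma prob_\<mu> [simp]: "measure \<mu> UNIV = 1"
  using M2.prob_space by simp

lemma law_eq: "distr joint borel (\<lambda>p. A (fst p) * snd p + B (fst p)) = \<mu>"
  using solution by (simp add: perpetuity_solution_def case_prod_beta')

lemma transform_measurable [measurable]: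
  "(\<lambda>p. A (fst p) * snd p + B (fst p)) \<in> borel_measurable joint"
  "(\<lambda>p. A (fst p) * snd p) \<in> borel_measurable joint"
  by measurable

lemma integral_law:
  fixes f :: "real \<Rightarrow> real"
  assumes [measurable]: "f \<in> borel_measurable borel"
  shows "(\<integral>x. f x \<partial>\<mu>) = (\<integral>p. f (A (fst p) * snd p + B (fst p)) \<partial>joint)"
    and "integrable \<mu> f \<longleftrightarrow> integrable joint (\<lambda>p. f (A (fst p) * snd p + B (fst p)))"
proof -
  show "(\<integral>x. f x \<partial>\<mu>) = (\<integral>p. f (A (fst p) * snd p + B (fst p)) \<partial>joint)"
    by (subst law_eq[symmetric], subst integral_distr) measurable
  show "integrable \<mu> f \<longleftrightarrow> integrable joint (\<lambda>p. f (A (fst p) * snd p + B (fst p)))"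
    by (subst law_eq[symmetric], subst integrable_distr_eq) measurable
qed

lemma joint_A_nonneg: "AE p in joint. A (fst p) \<ge> 0"
  using A_nonneg by (intro AE_pair_measure) auto

lemma integrable_joint_fst:
  fixes f :: "'a \<Rightarrow> real"
  assumes f: "integrable M f"
  shows "integrable joint (\<lambda>p. f (fst p))" "(\<integral>p. f (fst p) \<partial>joint) = (\<integral>\<omega>. f \<omega> \<partial>M)"
proof -
  note [measurable] = borel_measurable_integrable[OF f]
  show int: "integrable joint (\<lambda>p. f (fst p))"
    using f by (intro Fubini_integrable) auto
  show "(\<integral>p. f (fst p) \<partial>joint) = (\<integral>\<omega>. f \<omega> \<partial>M)"
    using integral_fst'[OF int] by simp
qed

lemma integrable_joint_product:
  fixes f :: "real \<Rightarrow> real"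
  assumes f: "integrable \<mu> f"
  shows "integrable joint (\<lambda>p. A (fst p) powr \<kappa> * f (snd p))"
    "(\<integral>p. A (fst p) powr \<kappa> * f (snd p) \<partial>joint) = \<theta> * (\<integral>x. f x \<partial>\<mu>)"
proof -
  note [measurable] = borel_measurable_integrable[OF f]
  show int: "integrable joint (\<lambda>p. A (fst p) powr \<kappa> * f (snd p))"
    using f A_moment by (intro Fubini_integrable) (auto simp: abs_mult)
  show "(\<integral>p. A (fst p) powr \<kappa> * f (snd p) \<partial>joint) = \<theta> * (\<integral>x. f x \<partial>\<mu>)"
    using integral_fst'[OF int] by (simp add: \<theta>_def moment_def)
qed

lemma B_moment_\<kappa>: "integrable M (\<lambda>\<omega>. \<bar>B \<omega>\<bar> powr \<kappa>)"
proof (rule Bochner_Integration.integrable_bound)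
  show "integrable M (\<lambda>\<omega>. 1 + \<bar>B \<omega>\<bar> powr \<nu>)"
    using B_moment by simp
  have "b powr \<kappa> \<le> 1 + b powr \<nu>" if "b \<ge> 0" for b :: real
  proof (cases "b \<ge> 1")
    case True
    then show ?thesis using \<nu> powr_mono[of \<kappa> \<nu> b] by simp
  next
    case False
    then show ?thesis using that \<kappa>_pos powr_le1[of \<kappa> b] powr_ge_zero[of b \<nu>] by linarith
  qed
  then show "AE \<omega> in M. norm (\<bar>B \<omega>\<bar> powr \<kappa>) \<le> norm (1 + \<bar>B \<omega>\<bar> powr \<nu>)" by simp
qed measurable

text \<open>
  The truncated moments satisfy the contraction inequality \<open>h c \<le> \<rho> (h at a rescaled
  truncation level) + C\<close>. The error term \<open>c powr \<kappa> * P(|X| > L)\<close> is exactly preserved by it,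
  which makes up for the rescaling.
\<close>

lemma truncated_moment_bounded:
  "\<exists>C\<ge>0. \<forall>c>0. (\<integral>x. min \<bar>x\<bar> c powr \<kappa> \<partial>\<mu>) \<le> C"
proof -
  define h where "h c = (\<integral>x. min \<bar>x\<bar> c powr \<kappa> \<partial>\<mu>)" for c
  define \<rho> where "\<rho> = (\<theta> + 1) / 2"
  have \<rho>: "0 \<le> \<rho>" "\<rho> < 1" "\<theta> < \<rho>" using \<theta> by (auto simp: \<rho>_def)
  \<comment> \<open>Chosen so that the \<kappa>-th moment of lam * A is \<rho>, midway between
    \<theta> and 1: enlarging A by lam > 1 makes room for B without losing the contraction.\<close>
  define lam where "lam = (\<rho> / \<theta>) powr (1 / \<kappa>)"
  have lam_powr: "lam powr \<kappa> = \<rho> / \<theta>"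
    using \<theta> \<rho> \<kappa>_pos by (simp add: lam_def powr_powr)
  have lam: "lam > 1"
    unfolding lam_def using \<theta> \<rho> \<kappa>_pos by (intro gr_one_powr) auto
  define D where "D = 1 + 1 / (lam - 1)"
  have D: "D > 0" using lam by (simp add: D_def add_pos_pos)
  define C where "C = D powr \<kappa> * (\<integral>\<omega>. \<bar>B \<omega>\<bar> powr \<kappa> \<partial>M)"
  have C: "C \<ge> 0" by (simp add: C_def)
  \<comment> \<open>Either \<bar>b\<bar> fits into the enlargement from a to lam * a, or a *
    \<bar>x\<bar> < \<bar>b\<bar> / (lam - 1), and then the whole sum is at most D *
    \<bar>b\<bar>.\<close>
  have split: "min \<bar>a * x + b\<bar> c powr \<kappa> \<le> min (lam * a * \<bar>x\<bar>) c powr \<kappa> + D powr \<kappa> * \<bar>b\<bar> powr \<kappa>"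
    if "a \<ge> 0" "c > 0" for a b c x
  proof (cases "\<bar>b\<bar> \<le> (lam - 1) * (a * \<bar>x\<bar>)")
    case True
    have "\<bar>a * x + b\<bar> \<le> a * \<bar>x\<bar> + \<bar>b\<bar>"
      using abs_triangle_ineq[of "a * x" b] that by (simp add: abs_mult)
    then have "min \<bar>a * x + b\<bar> c \<le> min (lam * a * \<bar>x\<bar>) c" using True by (simp add: algebra_simps)
    then have "min \<bar>a * x + b\<bar> c powr \<kappa> \<le> min (lam * a * \<bar>x\<bar>) c powr \<kappa>"
      using that \<kappa>_pos by (intro powr_mono2) auto
    then show ?thesis by (simp add: add_increasing2)
  next
    case False
    have "\<bar>a * x + b\<bar> \<le> a * \<bar>x\<bar> + \<bar>b\<bar>"
      using abs_triangle_ineq[of "a * x" b] that by (simp add: abs_mult)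
    also have "\<dots> \<le> D * \<bar>b\<bar>" using False lam by (simp add: D_def field_simps)
    finally have "min \<bar>a * x + b\<bar> c powr \<kappa> \<le> (D * \<bar>b\<bar>) powr \<kappa>"
      using that \<kappa>_pos by (intro powr_mono2) auto
    then show ?thesis by (simp add: powr_mult add_increasing)
  qed
  have scale: "(\<integral>x. min (lam * a * \<bar>x\<bar>) c powr \<kappa> \<partial>\<mu>) = (lam * a) powr \<kappa> * h (c / (lam * a))"
    if "a > 0" "c > 0" for a c
  proof -
    have "min (lam * a * \<bar>x\<bar>) c = (lam * a) * min \<bar>x\<bar> (c / (lam * a))" for x
      using that lam by (simp add: min_mult_distrib_left)
    then show ?thesis by (simp add: powr_mult h_def)
  qed
  have hbound: "integrable \<mu> (\<lambda>x. min \<bar>x\<bar> c powr \<kappa>)" if "c > 0" for c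
    using that \<kappa>_pos by (intro M2.integrable_const_bound[where B = "c powr \<kappa>"]) (auto intro!: powr_mono2)
  \<comment> \<open>Splitting at \<bar>x\<bar> = L gives the finite start
    \<open>L powr \<kappa>\<close>. The iteration forgets it, so L survives only in the tail
    probability, which vanishes as L grows with c fixed.\<close>
  have tail: "h c \<le> (C / (1 - \<rho>) + 1) + c powr \<kappa> * measure \<mu> {x. \<bar>x\<bar> > L}" if "L > 0" "c > 0" for L c
  proof -
    define \<delta> where "\<delta> = measure \<mu> {x. \<bar>x\<bar> > L}"
    define P where "P \<beta> \<longleftrightarrow> (\<forall>c>0. h c \<le> \<beta> + c powr \<kappa> * \<delta>)" for \<beta>
    have "P (C / (1 - \<rho>) + 1)"
    proof (rule affine_iteration_bound[where P = P and \<rho> = \<rho> and C = C])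
      show "P (L powr \<kappa>)"
        unfolding P_def
      proof (intro allI impI)
        fix c :: real assume c: "c > 0"
        have S: "{x. \<bar>x\<bar> > L} \<in> sets \<mu>" by measurable
        then have ind: "integrable \<mu> (\<lambda>x. c powr \<kappa> * indicator {x. \<bar>x\<bar> > L} x)"
          by (intro Bochner_Integration.integrable_mult_right integrable_real_indicator)
            (simp_all add: less_top[symmetric])
        have "h c \<le> (\<integral>x. L powr \<kappa> + c powr \<kappa> * indicator {x. \<bar>x\<bar> > L} x \<partial>\<mu>)"
          unfolding h_def
        proof (intro integral_mono hbound c Bochner_Integration.integrable_add ind M2.integrable_const)
          fix x
          show "min \<bar>x\<bar> c powr \<kappa> \<le> L powr \<kappa> + c powr \<kappa> * indicator {x. \<bar>x\<bar> > L} x"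
          proof (cases "\<bar>x\<bar> > L")
            case True
            have "min \<bar>x\<bar> c powr \<kappa> \<le> c powr \<kappa>" using c \<kappa>_pos by (intro powr_mono2) auto
            then show ?thesis using True by (simp add: add_increasing)
          next
            case False
            then show ?thesis using c \<kappa>_pos by (auto intro!: powr_mono2)
          qed
        qed
        also have "\<dots> = L powr \<kappa> + c powr \<kappa> * \<delta>"
          unfolding \<delta>_def using ind by (subst Bochner_Integration.integral_add) simp_all
        finally show "h c \<le> L powr \<kappa> + c powr \<kappa> * \<delta>" .
      qed
      show "P (\<rho> * \<beta> + C)" if \<beta>: "\<beta> \<ge> 0" and IH: "P \<beta>" for \<beta>
        unfolding P_def
      proof (intro allI impI)
        fix c :: real assume c: "c > 0"
        have int1: "integrable joint (\<lambda>p. min (lam * A (fst p) * \<bar>snd p\<bar>) c powr \<kappa>)"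
        proof (intro integrable_const_bound[where B = "c powr \<kappa>"])
          show "AE p in joint. norm (min (lam * A (fst p) * \<bar>snd p\<bar>) c powr \<kappa>) \<le> c powr \<kappa>"
            using joint_A_nonneg
          proof eventually_elim
            case (elim p)
            then show ?case using c \<kappa>_pos lam by (auto intro!: powr_mono2)
          qed
        qed measurable
        have int2: "integrable joint (\<lambda>p. D powr \<kappa> * \<bar>B (fst p)\<bar> powr \<kappa>)"
          by (intro Bochner_Integration.integrable_mult_right integrable_joint_fst B_moment_\<kappa>)
        have "h c = (\<integral>p. min \<bar>A (fst p) * snd p + B (fst p)\<bar> c powr \<kappa> \<partial>joint)"
          unfolding h_def by (rule integral_law) measurable
        also have "\<dots> \<le> (\<integral>p. min (lam * A (fst p) * \<bar>snd p\<bar>) c powr \<kappa> + D powr \<kappa> * \<bar>B (fst p)\<bar> powr \<kappa> \<partial>joint)"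
        proof (intro integral_mono_AE Bochner_Integration.integrable_add int1 int2)
          show "integrable joint (\<lambda>p. min \<bar>A (fst p) * snd p + B (fst p)\<bar> c powr \<kappa>)"
            using hbound[OF c] by (subst integral_law(2)[symmetric]) auto
          show "AE p in joint. min \<bar>A (fst p) * snd p + B (fst p)\<bar> c powr \<kappa>
              \<le> min (lam * A (fst p) * \<bar>snd p\<bar>) c powr \<kappa> + D powr \<kappa> * \<bar>B (fst p)\<bar> powr \<kappa>"
            using joint_A_nonneg by eventually_elim (rule split[OF _ c])
        qed
        also have "\<dots> = (\<integral>p. min (lam * A (fst p) * \<bar>snd p\<bar>) c powr \<kappa> \<partial>joint) + C"
          using int1 int2 integrable_joint_fst(2)[OF B_moment_\<kappa>] by (simp add: C_def)
        also have "(\<integral>p. min (lam * A (fst p) * \<bar>snd p\<bar>) c powr \<kappa> \<partial>joint)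
            = (\<integral>\<omega>. (\<integral>x. min (lam * A \<omega> * \<bar>x\<bar>) c powr \<kappa> \<partial>\<mu>) \<partial>M)"
          using integral_fst'[OF int1] by simp
        also have "\<dots> \<le> (\<integral>\<omega>. \<rho> / \<theta> * \<beta> * A \<omega> powr \<kappa> + c powr \<kappa> * \<delta> \<partial>M)"
        proof (intro integral_mono_AE)
          show "integrable M (\<lambda>\<omega>. \<integral>x. min (lam * A \<omega> * \<bar>x\<bar>) c powr \<kappa> \<partial>\<mu>)"
            using integrable_fst'[OF int1] by simp
          show "AE \<omega> in M. (\<integral>x. min (lam * A \<omega> * \<bar>x\<bar>) c powr \<kappa> \<partial>\<mu>) \<le> \<rho> / \<theta> * \<beta> * A \<omega> powr \<kappa> + c powr \<kappa> * \<delta>"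
            using A_nonneg
          proof eventually_elim
            case (elim \<omega>)
            show ?case
            proof (cases "A \<omega> = 0")
              case True
              then show ?thesis using c \<kappa>_pos by (simp add: \<delta>_def)
            next
              case False
              then have a: "A \<omega> > 0" using elim by simp
              have "(\<integral>x. min (lam * A \<omega> * \<bar>x\<bar>) c powr \<kappa> \<partial>\<mu>)
                  \<le> (lam * A \<omega>) powr \<kappa> * (\<beta> + (c / (lam * A \<omega>)) powr \<kappa> * \<delta>)"
                unfolding scale[OF a c] using IH a c lam unfolding P_def by (intro mult_left_mono) auto
              also have "\<dots> = \<rho> / \<theta> * \<beta> * A \<omega> powr \<kappa> + c powr \<kappa> * \<delta>"
                using a c lam by (simp add: powr_divide powr_mult lam_powr[symmetric] field_simps)
              finally show ?thesis .
            qed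
          qed
        qed (use A_moment in auto)
        also have "\<dots> = \<rho> * \<beta> + c powr \<kappa> * \<delta>"
          using A_moment \<theta> M1.prob_space by (simp add: \<theta>_def[unfolded moment_def, symmetric])
        finally show "h c \<le> \<rho> * \<beta> + C + c powr \<kappa> * \<delta>" by simp
      qed
      show "P \<beta>'" if "\<beta> \<le> \<beta>'" "P \<beta>" for \<beta> \<beta>'
        using that unfolding P_def by fastforce
    qed (use \<rho> C in auto)
    then show ?thesis using that by (simp add: P_def \<delta>_def)
  qed
  have "h c \<le> C / (1 - \<rho>) + 1" if c: "c > 0" for c
  proof (rule tendsto_lowerbound)
    have "(\<lambda>n. measure \<mu> {x. \<bar>x\<bar> > real n}) \<longlonglongrightarrow> measure \<mu> (\<Inter>n. {x. \<bar>x\<bar> > real n})"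
      by (intro M2.finite_Lim_measure_decseq) (auto simp: decseq_def)
    also have "(\<Inter>n. {x. \<bar>x\<bar> > real n}) = {}"
      by auto (meson leD real_arch_simple)
    finally show "(\<lambda>n. (C / (1 - \<rho>) + 1) + c powr \<kappa> * measure \<mu> {x. \<bar>x\<bar> > real n}) \<longlonglongrightarrow> C / (1 - \<rho>) + 1"
      by (auto intro!: tendsto_eq_intros)
    show "\<forall>\<^sub>F n in sequentially. h c \<le> (C / (1 - \<rho>) + 1) + c powr \<kappa> * measure \<mu> {x. \<bar>x\<bar> > real n}"
      using eventually_gt_at_top[of 0] by eventually_elim (use tail c in simp)
  qed simp
  then show ?thesis
    using C \<rho> unfolding h_def by (intro exI[of _ "C / (1 - \<rho>) + 1"]) auto
qed

lemma solution_moment: "integrable \<mu> (\<lambda>x. \<bar>x\<bar> powr \<kappa>)"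
proof -
  obtain C where C: "C \<ge> 0" "\<And>c. c > 0 \<Longrightarrow> (\<integral>x. min \<bar>x\<bar> c powr \<kappa> \<partial>\<mu>) \<le> C"
    using truncated_moment_bounded by blast
  let ?f = "\<lambda>n x. min \<bar>x\<bar> (real (Suc n)) powr \<kappa>"
  have "(\<integral>\<^sup>+x. ennreal (\<bar>x\<bar> powr \<kappa>) \<partial>\<mu>) = (\<integral>\<^sup>+x. liminf (\<lambda>n. ennreal (?f n x)) \<partial>\<mu>)"
  proof (intro nn_integral_cong)
    fix x :: real
    obtain m where m: "\<bar>x\<bar> \<le> real m" using real_arch_simple by blast
    have "\<forall>\<^sub>F n in sequentially. ennreal (\<bar>x\<bar> powr \<kappa>) = ennreal (?f n x)"
      using eventually_ge_at_top[of m] by eventually_elim (use m in \<open>simp add: min_def\<close>)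
    then have "(\<lambda>n. ennreal (?f n x)) \<longlonglongrightarrow> ennreal (\<bar>x\<bar> powr \<kappa>)"
      by (rule Lim_transform_eventually[OF tendsto_const])
    then show "ennreal (\<bar>x\<bar> powr \<kappa>) = liminf (\<lambda>n. ennreal (?f n x))"
      by (intro lim_imp_Liminf[symmetric]) auto
  qed
  also have "\<dots> \<le> liminf (\<lambda>n. \<integral>\<^sup>+x. ennreal (?f n x) \<partial>\<mu>)"
    by (intro nn_integral_liminf) measurable
  also have "\<dots> \<le> ennreal C"
  proof -
    have "(\<integral>\<^sup>+x. ennreal (?f n x) \<partial>\<mu>) \<le> ennreal C" for n
    proof -
      have "integrable \<mu> (?f n)"
        using \<kappa>_pos by (intro M2.integrable_const_bound[where B = "real (Suc n) powr \<kappa>"])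
          (auto intro!: powr_mono2)
      then show ?thesis
        using C(2)[of "real (Suc n)"] by (subst nn_integral_eq_integral) (auto intro!: ennreal_leI)
    qed
    then have "liminf (\<lambda>n. \<integral>\<^sup>+x. ennreal (?f n x) \<partial>\<mu>) \<le> liminf (\<lambda>n. ennreal C)"
      by (intro Liminf_mono always_eventually allI)
    then show ?thesis by (simp add: Liminf_const)
  qed
  finally show ?thesis
    by (intro integrableI_nonneg) (auto simp: le_less_trans)
qed

text \<open>A vanishing moment means X = 0 almost surely, and then the equation in law forces B = 0
  almost surely.\<close>

lemma moment_pos:
  assumes B: "\<P>(\<omega> in M. B \<omega> = 0) < 1"
  shows "(\<integral>x. \<bar>x\<bar> powr \<kappa> \<partial>\<mu>) > 0"
proof (rule ccontr)
  assume "\<not> ?thesis"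
  moreover have "(\<integral>x. \<bar>x\<bar> powr \<kappa> \<partial>\<mu>) \<ge> 0" by simp
  ultimately have "(\<integral>x. \<bar>x\<bar> powr \<kappa> \<partial>\<mu>) = 0" by linarith
  then have X: "AE x in \<mu>. x = 0"
    using integral_nonneg_eq_0_iff_AE[OF solution_moment] by simp
  then have "AE p in joint. A (fst p) * snd p + B (fst p) = 0"
    by (subst (asm) law_eq[symmetric], subst (asm) AE_distr_iff) auto
  moreover have "AE p in joint. snd p = 0"
    using X by (intro AE_pair_measure) auto
  ultimately have "AE p in joint. B (fst p) = 0"
    by eventually_elim simp
  then have "AE \<omega> in M. AE x in \<mu>. B \<omega> = 0"
    by (auto dest: AE_pair)
  then have "\<P>(\<omega> in M. B \<omega> = 0) = 1"
    by (subst M1.prob_Collect_eq_1) (auto simp: M2.AE_const)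
  with B show False by simp
qed

section \<open>Tails of the solution\<close>

definition tilted_law :: "real measure" where
  "tilted_law = interval_measure (tilted_df M A \<kappa>)"

lemma real_distribution_tilted_law: "real_distribution tilted_law"
  and cdf_tilted_law: "cdf tilted_law = tilted_df M A \<kappa>"
  using tilted_df_distribution_function[OF A_measurable A_moment] \<theta>
  by (simp_all add: tilted_law_def \<theta>_def)

text \<open>As a push-forward of the tilted probability, the law allows integrals against it to be
  evaluated over M. The density vanishes where A = 0, so the default \<open>ln 0 = 0\<close>
  contributes no mass.\<close>

lemma tilted_law_eq:
  "tilted_law = distr (density M (\<lambda>\<omega>. ennreal (A \<omega> powr \<kappa> / \<theta>))) borel (\<lambda>\<omega>. ln (A \<omega>))"
proof (rule cdf_unique)
  define D where "D = density M (\<lambda>\<omega>. ennreal (A \<omega> powr \<kappa> / \<theta>))"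
  have meas_D: "measure D S = (\<integral>\<omega>. A \<omega> powr \<kappa> / \<theta> * indicator S \<omega> \<partial>M)" if S: "S \<in> sets M" for S
  proof -
    have "emeasure D S = (\<integral>\<^sup>+\<omega>. ennreal (A \<omega> powr \<kappa> / \<theta> * indicator S \<omega>) \<partial>M)"
      unfolding D_def using S by (subst emeasure_density) (auto intro!: nn_integral_cong split: split_indicator)
    also have "\<dots> = ennreal (\<integral>\<omega>. A \<omega> powr \<kappa> / \<theta> * indicator S \<omega> \<partial>M)"
      using A_moment S \<theta> by (intro nn_integral_eq_integral integrable_real_mult_indicator) auto
    finally show ?thesis
      using \<theta> by (simp add: measure_def integral_nonneg_AE)
  qed
  have "emeasure D (space D) = (\<integral>\<^sup>+\<omega>. ennreal (A \<omega> powr \<kappa> / \<theta>) \<partial>M)"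
    unfolding D_def by (subst emeasure_density) (auto intro!: nn_integral_cong)
  also have "\<dots> = 1"
    using A_moment \<theta> by (subst nn_integral_eq_integral) (auto simp: \<theta>_def[unfolded moment_def, symmetric])
  finally interpret D: prob_space D by (rule prob_spaceI)
  show "real_distribution tilted_law" by (rule real_distribution_tilted_law)
  show "real_distribution (distr (density M (\<lambda>\<omega>. ennreal (A \<omega> powr \<kappa> / \<theta>))) borel (\<lambda>\<omega>. ln (A \<omega>)))"
    unfolding D_def[symmetric] by (rule D.real_distribution_distr) (simp add: D_def)
  have "cdf (distr D borel (\<lambda>\<omega>. ln (A \<omega>))) x = tilted_df M A \<kappa> x" for x
  proof -
    have "cdf (distr D borel (\<lambda>\<omega>. ln (A \<omega>))) x = measure D {\<omega> \<in> space M. ln (A \<omega>) \<le> x}"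
      unfolding cdf_def2 by (subst measure_distr) (auto simp: D_def intro!: arg_cong2[where f = measure])
    also have "\<dots> = (\<integral>\<omega>. inverse \<theta> * (indicator {\<omega>. A \<omega> = 0 \<or> ln (A \<omega>) \<le> x} \<omega> * A \<omega> powr \<kappa>) \<partial>M)"
      by (subst meas_D) (auto intro!: Bochner_Integration.integral_cong simp: field_simps split: split_indicator)
    finally show ?thesis
      by (simp add: tilted_df_def \<theta>_def)
  qed
  then show "cdf tilted_law = cdf (distr (density M (\<lambda>\<omega>. ennreal (A \<omega> powr \<kappa> / \<theta>))) borel (\<lambda>\<omega>. ln (A \<omega>)))"
    by (auto simp: cdf_tilted_law D_def)
qed

lemma integral_tilted_law:
  fixes h :: "real \<Rightarrow> real"
  assumes [measurable]: "h \<in> borel_measurable borel"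
  shows "\<theta> * (\<integral>y. h y \<partial>tilted_law) = (\<integral>\<omega>. A \<omega> powr \<kappa> * h (ln (A \<omega>)) \<partial>M)"
proof -
  have "(\<integral>y. h y \<partial>tilted_law) = (\<integral>\<omega>. (A \<omega> powr \<kappa> / \<theta>) *\<^sub>R h (ln (A \<omega>)) \<partial>M)"
    unfolding tilted_law_eq using \<theta>
    by (subst integral_distr, simp, simp, subst integral_density) auto
  then show ?thesis using \<theta> by simp
qed

end

text \<open>Collects what the positive and the negative part share, so that one argument yields both
  tails. Homogeneity turns multiplication by A into a shift of the logarithm; the Lipschitz bound
  limits the effect of B.\<close>

locale perpetuity_part = perpetuity +
  fixes \<phi> :: "real \<Rightarrow> real"
  assumes \<phi>_measurable [measurable]: "\<phi> \<in> borel_measurable borel"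
    and \<phi>_nonneg: "\<And>x. \<phi> x \<ge> 0"
    and \<phi>_scale: "\<And>a x. a \<ge> 0 \<Longrightarrow> \<phi> (a * x) = a * \<phi> x"
    and \<phi>_lipschitz: "\<And>x y. \<bar>\<phi> x - \<phi> y\<bar> \<le> \<bar>x - y\<bar>"
begin

definition part_moment :: real where
  "part_moment = (\<integral>x. \<phi> x powr \<kappa> \<partial>\<mu>)"

lemma \<phi>_le: "\<phi> x \<le> \<bar>x\<bar>"
  using \<phi>_lipschitz[of x 0] \<phi>_scale[of 0 0] \<phi>_nonneg[of x] by simp

lemma integrable_\<phi>: "integrable \<mu> (\<lambda>x. \<phi> x powr \<kappa>)"
proof (rule Bochner_Integration.integrable_bound[OF solution_moment])
  show "AE x in \<mu>. norm (\<phi> x powr \<kappa>) \<le> norm (\<bar>x\<bar> powr \<kappa>)"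
    using \<phi>_le \<phi>_nonneg \<kappa>_pos by (auto intro!: powr_mono2)
qed measurable

lemma part_moment_nonneg: "part_moment \<ge> 0"
  by (simp add: part_moment_def)

text \<open>Finiteness of the moment permits splitting the difference. By the equation in law the
  first term contributes \<open>part_moment\<close>; by homogeneity and independence the second
  contributes \<open>\<theta> * part_moment\<close>.\<close>

lemma goldie_integrand_integral:
  shows "integrable joint (goldie_integrand \<phi> A B \<kappa>)"
    and "(\<integral>p. goldie_integrand \<phi> A B \<kappa> p \<partial>joint) = (1 - \<theta>) * part_moment"
proof -
  have AE: "AE p in joint. \<phi> (A (fst p) * snd p) powr \<kappa> = A (fst p) powr \<kappa> * \<phi> (snd p) powr \<kappa>"
    using joint_A_nonneg by eventually_elim (simp add: \<phi>_scale powr_mult)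
  have int2: "integrable joint (\<lambda>p. \<phi> (A (fst p) * snd p) powr \<kappa>)"
    using integrable_joint_product(1)[OF integrable_\<phi>]
    by (subst integrable_cong_AE[OF _ _ AE]) measurable
  have eq2: "(\<integral>p. \<phi> (A (fst p) * snd p) powr \<kappa> \<partial>joint) = \<theta> * part_moment"
    unfolding part_moment_def integrable_joint_product(2)[OF integrable_\<phi>, symmetric]
    by (intro integral_cong_AE AE) measurable
  have int1: "integrable joint (\<lambda>p. \<phi> (A (fst p) * snd p + B (fst p)) powr \<kappa>)"
    using integrable_\<phi> by (subst integral_law(2)[symmetric]) auto
  have eq1: "(\<integral>p. \<phi> (A (fst p) * snd p + B (fst p)) powr \<kappa> \<partial>joint) = part_moment"
    unfolding part_moment_def by (subst integral_law(1)) auto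
  show "integrable joint (goldie_integrand \<phi> A B \<kappa>)"
    unfolding goldie_integrand_def case_prod_beta' using int1 int2 by simp
  show "(\<integral>p. goldie_integrand \<phi> A B \<kappa> p \<partial>joint) = (1 - \<theta>) * part_moment"
    unfolding goldie_integrand_def case_prod_beta' Bochner_Integration.integral_diff[OF int1 int2] eq1 eq2
    by (simp add: algebra_simps)
qed

text \<open>
  The truncated moment \<open>trunc x\<close> equals the integral of \<open>exp (\<kappa> * s) * P(\<phi> X > exp s)\<close> over
  \<open>s \<le> x\<close>; working with it avoids integrating over \<open>s\<close>.
\<close>

definition trunc :: "real \<Rightarrow> real" where
  "trunc x = (\<integral>a. min (\<phi> a) (exp x) powr \<kappa> / \<kappa> \<partial>\<mu>)"

text \<open>The integral of exp (\<kappa> * s) over those s in (x, x + T] with exp s < \<phi>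
  a.\<close>

definition window :: "real \<Rightarrow> real \<Rightarrow> real \<Rightarrow> real" where
  "window T x a = min (\<phi> a) (exp (x + T)) powr \<kappa> / \<kappa> - min (\<phi> a) (exp x) powr \<kappa> / \<kappa>"

lemma window_measurable [measurable]: "window T x \<in> borel_measurable borel"
  unfolding window_def by measurable

lemma window_bounds:
  assumes "T > 0"
  shows "0 \<le> window T x a" "window T x a \<le> exp (x + T) powr \<kappa> / \<kappa>"
proof -
  have "min (\<phi> a) (exp x) powr \<kappa> \<le> min (\<phi> a) (exp (x + T)) powr \<kappa>"
    using assms \<phi>_nonneg[of a] \<kappa>_pos by (intro powr_mono2) (auto intro: min.coboundedI2)
  then show "0 \<le> window T x a"
    using \<kappa>_pos by (simp add: window_def divide_right_mono)
  have "min (\<phi> a) (exp (x + T)) powr \<kappa> \<le> exp (x + T) powr \<kappa>"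
    using \<phi>_nonneg[of a] \<kappa>_pos by (intro powr_mono2) auto
  then have "min (\<phi> a) (exp (x + T)) powr \<kappa> / \<kappa> \<le> exp (x + T) powr \<kappa> / \<kappa>"
    using \<kappa>_pos by (intro divide_right_mono) auto
  moreover have "0 \<le> min (\<phi> a) (exp x) powr \<kappa> / \<kappa>" using \<kappa>_pos by simp
  ultimately show "window T x a \<le> exp (x + T) powr \<kappa> / \<kappa>"
    unfolding window_def by linarith
qed

lemma trunc_integrable: "integrable \<mu> (\<lambda>a. min (\<phi> a) (exp x) powr \<kappa> / \<kappa>)"
proof (intro integrable_divide Bochner_Integration.integrable_bound[OF integrable_\<phi>])
  show "AE a in \<mu>. norm (min (\<phi> a) (exp x) powr \<kappa>) \<le> norm (\<phi> a powr \<kappa>)"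
    using \<phi>_nonneg \<kappa>_pos by (auto intro!: powr_mono2)
qed measurable

lemma trunc_diff: "trunc (x + T) - trunc x = (\<integral>a. window T x a \<partial>\<mu>)"
  unfolding trunc_def window_def by (simp only: Bochner_Integration.integral_diff trunc_integrable)

lemma trunc_bound: "norm (min (\<phi> a) (exp x) powr \<kappa> / \<kappa>) \<le> \<phi> a powr \<kappa> / \<kappa>"
  using \<phi>_nonneg[of a] \<kappa>_pos by (auto intro!: powr_mono2 divide_right_mono)

lemma trunc_mono: "x \<le> y \<Longrightarrow> trunc x \<le> trunc y"
  unfolding trunc_def using \<phi>_nonneg \<kappa>_pos
  by (intro integral_mono trunc_integrable divide_right_mono powr_mono2) (auto intro: min.coboundedI2)

lemma isCont_trunc: "isCont trunc x"
  unfolding continuous_at_sequentially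
proof (intro allI impI)
  fix X assume X: "X \<longlonglongrightarrow> x"
  have "(\<lambda>n. \<integral>a. min (\<phi> a) (exp (X n)) powr \<kappa> / \<kappa> \<partial>\<mu>) \<longlonglongrightarrow> (\<integral>a. min (\<phi> a) (exp x) powr \<kappa> / \<kappa> \<partial>\<mu>)"
  proof (rule integral_dominated_convergence[where w = "\<lambda>a. \<phi> a powr \<kappa> / \<kappa>"])
    show "integrable \<mu> (\<lambda>a. \<phi> a powr \<kappa> / \<kappa>)" using integrable_\<phi> by simp
    show "AE a in \<mu>. (\<lambda>n. min (\<phi> a) (exp (X n)) powr \<kappa> / \<kappa>) \<longlonglongrightarrow> min (\<phi> a) (exp x) powr \<kappa> / \<kappa>"
      using X \<kappa>_pos \<phi>_nonneg by (intro AE_I2 tendsto_intros tendsto_powr2) (auto intro!: always_eventually)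
  qed (use trunc_bound in auto)
  then show "(trunc \<circ> X) \<longlonglongrightarrow> trunc x" by (simp add: trunc_def o_def)
qed

lemma trunc_at_bot: "(trunc \<longlongrightarrow> 0) at_bot"
proof -
  have "((\<lambda>x. \<integral>a. min (\<phi> a) (exp (- x)) powr \<kappa> / \<kappa> \<partial>\<mu>) \<longlongrightarrow> (\<integral>a. 0 \<partial>\<mu>)) at_top"
  proof (rule integral_dominated_convergence_at_top[where w = "\<lambda>a. \<phi> a powr \<kappa> / \<kappa>"])
    show "integrable \<mu> (\<lambda>a. \<phi> a powr \<kappa> / \<kappa>)" using integrable_\<phi> by simp
    show "AE a in \<mu>. ((\<lambda>x. min (\<phi> a) (exp (- x)) powr \<kappa> / \<kappa>) \<longlongrightarrow> 0) at_top"
    proof (intro AE_I2)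
      fix a
      have "((\<lambda>x. exp (- x)) \<longlongrightarrow> (0::real)) at_top"
        by (intro filterlim_compose[OF exp_at_bot] filterlim_uminus_at_bot_at_top)
      then have *: "((\<lambda>x. min (\<phi> a) (exp (- x))) \<longlongrightarrow> min (\<phi> a) 0) at_top"
        by (intro tendsto_intros)
      then have "((\<lambda>x. min (\<phi> a) (exp (- x)) powr \<kappa> / \<kappa>) \<longlongrightarrow> min (\<phi> a) 0 powr \<kappa> / \<kappa>) at_top"
        using \<kappa>_pos \<phi>_nonneg
        by (intro tendsto_divide tendsto_powr2[OF * tendsto_const] tendsto_const) (auto intro!: always_eventually)
      then show "((\<lambda>x. min (\<phi> a) (exp (- x)) powr \<kappa> / \<kappa>) \<longlongrightarrow> 0) at_top"
        using min_absorb2[OF \<phi>_nonneg[of a]] by simp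
    qed
  qed (use trunc_bound in auto)
  then show ?thesis by (simp add: trunc_def filterlim_at_bot_mirror)
qed

lemma trunc_at_top: "(trunc \<longlongrightarrow> part_moment / \<kappa>) at_top"
proof -
  have "((\<lambda>x. \<integral>a. min (\<phi> a) (exp x) powr \<kappa> / \<kappa> \<partial>\<mu>) \<longlongrightarrow> (\<integral>a. \<phi> a powr \<kappa> / \<kappa> \<partial>\<mu>)) at_top"
  proof (rule integral_dominated_convergence_at_top[where w = "\<lambda>a. \<phi> a powr \<kappa> / \<kappa>"])
    show "integrable \<mu> (\<lambda>a. \<phi> a powr \<kappa> / \<kappa>)" using integrable_\<phi> by simp
    show "AE a in \<mu>. ((\<lambda>x. min (\<phi> a) (exp x) powr \<kappa> / \<kappa>) \<longlongrightarrow> \<phi> a powr \<kappa> / \<kappa>) at_top"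
    proof (intro AE_I2 tendsto_eventually)
      fix a
      have "\<forall>\<^sub>F x in at_top. exp x \<ge> \<phi> a"
        using exp_at_top by (auto simp: filterlim_at_top)
      then show "\<forall>\<^sub>F x in at_top. min (\<phi> a) (exp x) powr \<kappa> / \<kappa> = \<phi> a powr \<kappa> / \<kappa>"
        by eventually_elim (simp add: min_def)
    qed
  qed (use trunc_bound in auto)
  then show ?thesis by (simp add: trunc_def[abs_def] part_moment_def)
qed

text \<open>The measure with density exp (\<kappa> * s) * P(\<phi> X > exp s), to which the renewal
  argument is applied. Its mass is finite by \<open>solution_moment\<close>.\<close>

definition trunc_measure :: "real measure" where
  "trunc_measure = interval_measure trunc"

lemma trunc_measure:
  shows "finite_borel_measure trunc_measure"
    and "measure trunc_measure UNIV = part_moment / \<kappa>"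
    and "T > 0 \<Longrightarrow> incr (cdf trunc_measure) T x = (\<integral>a. window T x a \<partial>\<mu>)"
proof -
  have right: "continuous (at_right x) trunc" for x
    using isCont_trunc by (rule continuous_at_imp_continuous_at_within)
  have nonneg: "part_moment / \<kappa> \<ge> 0" using part_moment_nonneg \<kappa>_pos by simp
  note facts = trunc_mono right trunc_at_bot
  show fin: "finite_borel_measure trunc_measure"
    unfolding trunc_measure_def
    by (rule finite_borel_measure_interval_measure[OF facts trunc_at_top nonneg])
  show "measure trunc_measure UNIV = part_moment / \<kappa>"
    unfolding trunc_measure_def measure_def
    by (subst interval_measure_UNIV[OF facts trunc_at_top nonneg]) (use nonneg in simp_all)
  show "incr (cdf trunc_measure) T x = (\<integral>a. window T x a \<partial>\<mu>)" if "T > 0"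
    unfolding trunc_diff[symmetric] trunc_measure_def incr_def
    by (simp add: cdf_interval_measure[OF facts])
qed

text \<open>Here the tilt originates: multiplication by a shifts the window by ln a and leaves the
  weight \<open>a powr \<kappa>\<close>, which up to \<theta> is the density behind
  \<open>tilted_law\<close>.\<close>

lemma window_scale:
  assumes "a > 0"
  shows "window T x (a * b) = a powr \<kappa> * window T (x - ln a) b"
proof -
  have "min (\<phi> (a * b)) (exp z) = a * min (\<phi> b) (exp (z - ln a))" for z
    using assms by (simp add: \<phi>_scale exp_diff min_mult_distrib_left)
  then show ?thesis
    by (simp add: window_def powr_mult right_diff_distrib diff_add_eq)
qed

text \<open>By the equation in law, u x is the expectation of the window functional at A X + B; by
  \<open>window_scale\<close> and the change of measure, the convolution term is its expectation at
  A X. The functionals differ by at most exp (- \<delta> * x) / \<kappa> times the difference of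
  p-th powers, whose expectation needs only moments of order \<kappa> of A X and \<nu> of B.\<close>

lemma renewal_estimate:
  assumes T: "T > 0"
  defines "u \<equiv> incr (cdf trunc_measure) T"
  shows "\<exists>C\<ge>0. \<exists>\<delta>>0. \<forall>x. \<bar>u x - \<theta> * (\<integral>y. u (x - y) \<partial>tilted_law)\<bar> \<le> C * exp (- \<delta> * x)"
proof -
  define p where "p = \<nu> * (\<kappa> + 1) / (\<nu> + 1)"
  \<comment> \<open>Equals (\<nu> - \<kappa>) / (\<nu> + 1): the rate measures the surplus moment of
    B.\<close>
  define \<delta> where "\<delta> = p - \<kappa>"
  have \<delta>: "\<delta> > 0" using \<kappa>_pos \<nu> by (simp add: \<delta>_def p_def field_simps)
  obtain C where C: "C \<ge> 0" and perturb: "\<And>a b c. 0 \<le> a \<Longrightarrow> 0 \<le> b \<Longrightarrow> \<bar>a - b\<bar> \<le> c \<Longrightarrow>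
      \<bar>a powr p - b powr p\<bar> \<le> C * (1 + b powr \<kappa> + c powr \<nu>)"
    using powr_perturbation_bound[OF \<kappa>_pos \<nu>] unfolding p_def by blast
  interpret Q: finite_borel_measure trunc_measure by (rule trunc_measure)
  have u_eq: "u x = (\<integral>a. window T x a \<partial>\<mu>)" for x
    unfolding u_def by (rule trunc_measure(3)[OF T])
  have [measurable]: "u \<in> borel_measurable borel" by (simp add: u_def)
  have int2: "integrable joint (\<lambda>p. window T x (A (fst p) * snd p))" for x
    using window_bounds[OF T] by (intro integrable_const_bound[where B = "exp (x + T) powr \<kappa> / \<kappa>"]) auto
  have int1: "integrable joint (\<lambda>p. window T x (A (fst p) * snd p + B (fst p)))" for x
    using window_bounds[OF T] by (intro integrable_const_bound[where B = "exp (x + T) powr \<kappa> / \<kappa>"]) auto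
  have eq1: "u x = (\<integral>p. window T x (A (fst p) * snd p + B (fst p)) \<partial>joint)" for x
    unfolding u_eq by (rule integral_law) simp
  have eq2: "\<theta> * (\<integral>y. u (x - y) \<partial>tilted_law) = (\<integral>p. window T x (A (fst p) * snd p) \<partial>joint)" for x
  proof -
    have "\<theta> * (\<integral>y. u (x - y) \<partial>tilted_law) = (\<integral>\<omega>. A \<omega> powr \<kappa> * u (x - ln (A \<omega>)) \<partial>M)"
      by (rule integral_tilted_law) measurable
    also have "\<dots> = (\<integral>\<omega>. (\<integral>a. window T x (A \<omega> * a) \<partial>\<mu>) \<partial>M)"
    proof (rule integral_cong_AE)
      show "(\<lambda>\<omega>. \<integral>a. window T x (A \<omega> * a) \<partial>\<mu>) \<in> borel_measurable M"
        using borel_measurable_integrable[OF integrable_fst'[OF int2[of x]]] by simp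
      show "AE \<omega> in M. A \<omega> powr \<kappa> * u (x - ln (A \<omega>)) = (\<integral>a. window T x (A \<omega> * a) \<partial>\<mu>)"
        using A_nonneg
      proof eventually_elim
        case (elim \<omega>)
        \<comment> \<open>At A = 0 the weight \<open>0 powr \<kappa>\<close> is 0. It cancels the
          spurious value u (x - ln 0) and agrees with the window functional at 0.\<close>
        have "window T x 0 = 0" using \<phi>_scale[of 0 0] by (simp add: window_def)
        then show ?case
          using elim by (cases "A \<omega> = 0") (simp_all add: u_eq window_scale)
      qed
    qed measurable
    also have "\<dots> = (\<integral>p. window T x (A (fst p) * snd p) \<partial>joint)"
      using integral_fst'[OF int2[of x]] by simp
    finally show ?thesis .
  qed
  define R where "R p = C * (1 + A (fst p) powr \<kappa> * \<bar>snd p\<bar> powr \<kappa> + \<bar>B (fst p)\<bar> powr \<nu>)" for p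
  have int_R: "integrable joint R"
    unfolding R_def
    by (intro Bochner_Integration.integrable_mult_right Bochner_Integration.integrable_add
        integrable_joint_product solution_moment integrable_joint_fst B_moment) simp
  have unscale: "\<kappa> * \<bar>r / \<kappa>\<bar> = \<bar>r\<bar>" for r
    using \<kappa>_pos by simp
  have "\<bar>u x - \<theta> * (\<integral>y. u (x - y) \<partial>tilted_law)\<bar> \<le> (\<integral>p. R p \<partial>joint) / \<kappa> * exp (- \<delta> * x)" for x
  proof -
    have "\<bar>u x - \<theta> * (\<integral>y. u (x - y) \<partial>tilted_law)\<bar>
        = \<bar>\<integral>p. window T x (A (fst p) * snd p + B (fst p)) - window T x (A (fst p) * snd p) \<partial>joint\<bar>"
      unfolding eq1[of x] eq2 by (simp add: int1 int2)
    also have "\<dots> \<le> (\<integral>p. \<bar>window T x (A (fst p) * snd p + B (fst p)) - window T x (A (fst p) * snd p)\<bar> \<partial>joint)"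
      by (rule integral_abs_bound)
    also have "\<dots> \<le> (\<integral>p. R p / \<kappa> * exp (- \<delta> * x) \<partial>joint)"
    proof (intro integral_mono_AE)
      show "AE q in joint. \<bar>window T x (A (fst q) * snd q + B (fst q)) - window T x (A (fst q) * snd q)\<bar>
          \<le> R q / \<kappa> * exp (- \<delta> * x)"
        using joint_A_nonneg
      proof eventually_elim
        case (elim q)
        define v where "v = \<phi> (A (fst q) * snd q + B (fst q))"
        define w where "w = \<phi> (A (fst q) * snd q)"
        have "exp x powr \<delta> * \<bar>(min v (exp (x + T)) powr \<kappa> - min v (exp x) powr \<kappa>)
            - (min w (exp (x + T)) powr \<kappa> - min w (exp x) powr \<kappa>)\<bar> \<le> \<bar>v powr p - w powr p\<bar>"
          unfolding \<delta>_def using \<delta> \<kappa>_pos T \<phi>_nonneg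
          by (intro truncated_powr_diff_le) (auto simp: \<delta>_def v_def w_def)
        also have "\<dots> \<le> C * (1 + w powr \<kappa> + \<bar>B (fst q)\<bar> powr \<nu>)"
          using \<phi>_nonneg \<phi>_lipschitz[of "A (fst q) * snd q + B (fst q)" "A (fst q) * snd q"]
          by (intro perturb) (auto simp: v_def w_def)
        also have "\<dots> \<le> R q"
        proof -
          have "w powr \<kappa> \<le> (A (fst q) * \<bar>snd q\<bar>) powr \<kappa>"
            using elim \<phi>_nonneg \<phi>_le[of "A (fst q) * snd q"] \<kappa>_pos
            by (intro powr_mono2) (auto simp: w_def abs_mult)
          then show ?thesis
            unfolding R_def using C by (intro mult_left_mono) (auto simp: powr_mult)
        qed
        finally have "exp (\<delta> * x) * (\<kappa> * \<bar>window T x (A (fst q) * snd q + B (fst q))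
            - window T x (A (fst q) * snd q)\<bar>) \<le> R q"
          unfolding window_def v_def w_def diff_divide_distrib[symmetric] unscale exp_powr_real mult.commute[of x] .
        then show ?case
          using \<kappa>_pos by (simp add: exp_minus field_simps)
      qed
    qed (use int1 int2 int_R in auto)
    finally show ?thesis by simp
  qed
  moreover have "(\<integral>p. R p \<partial>joint) / \<kappa> \<ge> 0"
    using C \<kappa>_pos unfolding R_def by (intro divide_nonneg_pos Bochner_Integration.integral_nonneg) auto
  ultimately show ?thesis using \<delta> by blast
qed

text \<open>
  Both half lines \<open>\<phi> > exp x\<close> and \<open>\<phi> \<ge> exp x\<close> are admitted for the tail \<open>H\<close>, because the two
  assertions of the theorem differ in this respect.
\<close>

lemma tail_asymp:
  fixes g H :: "real \<Rightarrow> real"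
  defines "g \<equiv> incr (cdf tilted_law) 1"
  assumes law: "locally_subexponential_law tilted_law"
    and lower: "\<And>x. measure \<mu> {a. \<phi> a > exp x} \<le> H x"
    and upper: "\<And>x. H x \<le> measure \<mu> {a. \<phi> a \<ge> exp x}"
  shows "((\<lambda>x. exp (\<kappa> * x) * H x / g x) \<longlongrightarrow> \<theta> / (1 - \<theta>) * (part_moment / \<kappa>)) at_top"
proof (rule tendstoI)
  interpret L: locally_subexponential_law tilted_law g
    unfolding g_def by (rule law)
  interpret Q: finite_borel_measure trunc_measure by (rule trunc_measure)
  define c where "c = \<theta> / (1 - \<theta>) * (part_moment / \<kappa>)"
  define u where "u T x = (\<integral>a. window T x a \<partial>\<mu>)" for T x
  have u_lim: "((\<lambda>x. u (1 / real n) x / g x) \<longlongrightarrow> c * (1 / real n)) at_top" if n: "n > 0" for n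
  proof -
    define T where "T = 1 / real n"
    have T: "T > 0" using n by (simp add: T_def)
    obtain C \<delta> where C: "C \<ge> 0" "\<delta> > 0" and est: "\<And>x. \<bar>incr (cdf trunc_measure) T x
        - \<theta> * (\<integral>y. incr (cdf trunc_measure) T (x - y) \<partial>tilted_law)\<bar> \<le> C * exp (- \<delta> * x)"
      using renewal_estimate[OF T] by blast
    have renewal: "\<forall>\<^sub>F x in at_top. \<bar>incr (cdf trunc_measure) T x
        - \<theta> * (\<integral>y. incr (cdf trunc_measure) T (x - y) \<partial>tilted_law)\<bar> \<le> \<epsilon> * g x" if "\<epsilon> > 0" for \<epsilon>
      using L.exp_neg_negligible[OF C(2) that C(1)] by eventually_elim (rule order_trans[OF est])
    interpret W: window_renewal tilted_law g trunc_measure n \<theta> T "incr (cdf trunc_measure) T"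
      unfolding T_def using n \<theta> by unfold_locales (simp_all only: less_imp_le renewal[unfolded T_def g_def])
    show ?thesis
      using W.window_asymp unfolding trunc_measure(2) T_def trunc_measure(3)[OF T[unfolded T_def]] u_def c_def
      by (simp add: mult_ac)
  qed
  fix e :: real assume e: "e > 0"
  \<comment> \<open>Sandwiching the tail between adjacent windows costs the factor \<kappa> * T /
    (exp (\<kappa> * T) - 1), on one side times exp (\<kappa> * T). Both costs tend to 1 as T = 1 /
    n shrinks, so n is fixed within the tolerance e before x grows.\<close>
  have s_lim: "(\<lambda>n. \<kappa> / real n) \<longlonglongrightarrow> 0"
    by (rule lim_const_over_n)
  have "((\<lambda>h. (exp h - 1) / h) \<longlongrightarrow> (1::real)) (at 0)"
    using DERIV_exp[of "0::real"] by (simp add: DERIV_def)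
  moreover have "filterlim (\<lambda>n. \<kappa> / real n) (at 0) sequentially"
    using s_lim \<kappa>_pos unfolding filterlim_at
    by (auto intro: eventually_mono[OF eventually_gt_at_top[of 0]])
  ultimately have "(\<lambda>n. (exp (\<kappa> / real n) - 1) / (\<kappa> / real n)) \<longlonglongrightarrow> 1"
    by (rule filterlim_compose)
  then have lim1: "(\<lambda>n. c * inverse ((exp (\<kappa> / real n) - 1) / (\<kappa> / real n))) \<longlonglongrightarrow> c * inverse 1"
    by (intro tendsto_intros) auto
  have lim2: "(\<lambda>n. c * inverse ((exp (\<kappa> / real n) - 1) / (\<kappa> / real n)) * exp (\<kappa> / real n))
      \<longlonglongrightarrow> c * inverse 1 * exp 0"
    by (rule tendsto_mult[OF lim1 tendsto_exp[OF s_lim]])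
  have
    "\<forall>\<^sub>F n in sequentially. c * inverse ((exp (\<kappa> / real n) - 1) / (\<kappa> / real n)) > c - e"
    "\<forall>\<^sub>F n in sequentially. c * inverse ((exp (\<kappa> / real n) - 1) / (\<kappa> / real n)) * exp (\<kappa> / real n) < c + e"
    using e order_tendstoD(1)[OF lim1, of "c - e"] order_tendstoD(2)[OF lim2, of "c + e"] by auto
  then have "\<forall>\<^sub>F n in sequentially. n > 0
      \<and> c * inverse ((exp (\<kappa> / real n) - 1) / (\<kappa> / real n)) > c - e
      \<and> c * inverse ((exp (\<kappa> / real n) - 1) / (\<kappa> / real n)) * exp (\<kappa> / real n) < c + e"
    using eventually_gt_at_top[of 0] by eventually_elim simp
  then obtain n where n: "n > 0"
    and n1: "c * inverse ((exp (\<kappa> / real n) - 1) / (\<kappa> / real n)) > c - e"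
    and n2: "c * inverse ((exp (\<kappa> / real n) - 1) / (\<kappa> / real n)) * exp (\<kappa> / real n) < c + e"
    by (auto simp: eventually_sequentially)
  define T where "T = 1 / real n"
  define E where "E = exp (\<kappa> * T)"
  have T: "T > 0" using n by (simp add: T_def)
  have E: "E > 1" using T \<kappa>_pos by (simp add: E_def)
  have pow: "exp z powr \<kappa> = exp (\<kappa> * z)" for z by (simp add: powr_def)
  have expT: "exp (\<kappa> * (z + T)) = exp (\<kappa> * z) * E" for z
    by (simp add: E_def distrib_left exp_add)
  have ind: "integrable \<mu> (\<lambda>a. b * indicator {a. P a} a)" if "{a. P a} \<in> sets \<mu>" for b :: real and P
    using that by (intro Bochner_Integration.integrable_mult_right integrable_real_indicator)
      (simp_all add: less_top[symmetric])
  have int: "integrable \<mu> (window T x)" for x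
    unfolding window_def by (intro Bochner_Integration.integrable_diff trunc_integrable)
  \<comment> \<open>On (x, x + T] the tail is at most H x, and exp (\<kappa> * s) integrates to exp
    (\<kappa> * x) * (E - 1) / \<kappa>.\<close>
  have u_upper: "\<kappa> * u T x \<le> (E - 1) * (exp (\<kappa> * x) * H x)" for x
  proof -
    have "u T x \<le> (\<integral>a. exp (\<kappa> * x) * (E - 1) / \<kappa> * indicator {a. \<phi> a > exp x} a \<partial>\<mu>)"
      unfolding u_def
    proof (intro integral_mono int ind)
      fix a
      show "window T x a \<le> exp (\<kappa> * x) * (E - 1) / \<kappa> * indicator {a. \<phi> a > exp x} a"
      proof (cases "\<phi> a > exp x")
        case True
        have "min (\<phi> a) (exp (x + T)) powr \<kappa> \<le> exp (x + T) powr \<kappa>"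
          using \<phi>_nonneg[of a] \<kappa>_pos by (intro powr_mono2) auto
        also have "\<dots> = exp (\<kappa> * x) * E"
          unfolding pow expT ..
        finally show ?thesis
          using True \<kappa>_pos by (simp add: window_def min_absorb2 pow field_simps)
      next
        case False
        then have "\<phi> a \<le> exp (x + T)" using T by (auto intro: order_trans[of _ "exp x"])
        then show ?thesis using False by (simp add: window_def)
      qed
    qed measurable
    also have "\<dots> = exp (\<kappa> * x) * (E - 1) / \<kappa> * measure \<mu> {a. \<phi> a > exp x}" by simp
    also have "\<dots> \<le> exp (\<kappa> * x) * (E - 1) / \<kappa> * H x"
      using E \<kappa>_pos by (intro mult_left_mono lower) auto
    finally show ?thesis using \<kappa>_pos by (simp add: field_simps)
  qed
  \<comment> \<open>The window from x - T to x lies to the left, where the tail is at least H x.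
    Shifting back by T is the source of the factor E and of the need for
    \<open>L.g_shift\<close>.\<close>
  have u_lower: "(E - 1) * (exp (\<kappa> * x) * H x) \<le> E * (\<kappa> * u T (x - T))" for x
  proof -
    have split: "exp (\<kappa> * x) = exp (\<kappa> * (x - T)) * E" using expT[of "x - T"] by simp
    have "exp (\<kappa> * (x - T)) * (E - 1) / \<kappa> * H x
        \<le> exp (\<kappa> * (x - T)) * (E - 1) / \<kappa> * measure \<mu> {a. \<phi> a \<ge> exp x}"
      using E \<kappa>_pos by (intro mult_left_mono upper) auto
    also have "\<dots> = (\<integral>a. exp (\<kappa> * (x - T)) * (E - 1) / \<kappa> * indicator {a. \<phi> a \<ge> exp x} a \<partial>\<mu>)" by simp
    also have "\<dots> \<le> u T (x - T)"
      unfolding u_def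
    proof (intro integral_mono int ind)
      fix a
      show "exp (\<kappa> * (x - T)) * (E - 1) / \<kappa> * indicator {a. \<phi> a \<ge> exp x} a \<le> window T (x - T) a"
      proof (cases "\<phi> a \<ge> exp x")
        case True
        moreover from this have "\<phi> a \<ge> exp (x - T)" using T by (auto intro: order_trans[of _ "exp x"])
        ultimately show ?thesis
          using \<kappa>_pos by (simp add: window_def pow split min_absorb2 diff_divide_distrib[symmetric] right_diff_distrib)
      next
        case False
        then show ?thesis using window_bounds(1)[OF T] by simp
      qed
    qed measurable
    finally have "E * (exp (\<kappa> * (x - T)) * (E - 1) * H x) \<le> E * (\<kappa> * u T (x - T))"
      using \<kappa>_pos E by (intro mult_left_mono) (auto simp: field_simps)
    then show ?thesis by (simp only: split mult_ac)
  qed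
  note lim = u_lim[OF n, folded T_def]
  have scaled: "c * inverse ((exp (\<kappa> / real n) - 1) / (\<kappa> / real n)) = \<kappa> / (E - 1) * (c * T)"
    by (simp add: E_def T_def field_simps)
  have "((\<lambda>x. \<kappa> / (E - 1) * (u T x / g x)) \<longlongrightarrow> \<kappa> / (E - 1) * (c * T)) at_top"
    by (intro tendsto_mult_left lim)
  then have ev1: "\<forall>\<^sub>F x in at_top. \<kappa> / (E - 1) * (u T x / g x) > c - e"
    using n1 unfolding scaled by (rule order_tendstoD(1))
  have shift: "filterlim (\<lambda>x. x + - T) at_top at_top"
    using filterlim_tendsto_add_at_top[OF tendsto_const filterlim_ident, of "- T"] by (simp add: add.commute)
  have "((\<lambda>x. \<kappa> / (E - 1) * (u T (x + - T) / g (x + - T)) * E * (g (x + - T) / g x))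
      \<longlongrightarrow> \<kappa> / (E - 1) * (c * T) * E * 1) at_top"
    by (intro tendsto_mult tendsto_const L.g_shift filterlim_compose[OF lim shift])
  moreover have "\<kappa> / (E - 1) * (c * T) * E * 1 < c + e"
    using n2 unfolding scaled by (simp add: E_def T_def)
  ultimately have ev2: "\<forall>\<^sub>F x in at_top.
      \<kappa> / (E - 1) * (u T (x + - T) / g (x + - T)) * E * (g (x + - T) / g x) < c + e"
    by (rule order_tendstoD(2))
  have "\<forall>\<^sub>F x in at_top. g (x + - T) > 0"
    using L.g_pos shift by (rule eventually_compose_filterlim)
  with ev1 ev2 L.g_pos
  show "\<forall>\<^sub>F x in at_top. dist (exp (\<kappa> * x) * H x / g x) (\<theta> / (1 - \<theta>) * (part_moment / \<kappa>)) < e"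
    unfolding c_def[symmetric]
  proof eventually_elim
    case (elim x)
    define t where "t = exp (\<kappa> * x) * H x"
    have "\<kappa> * u T x / (E - 1) \<le> t"
      using u_upper[of x] E by (simp add: t_def pos_divide_le_eq mult.commute)
    then have "\<kappa> * u T x / (E - 1) / g x \<le> t / g x"
      using elim by (intro divide_right_mono) auto
    then have "\<kappa> / (E - 1) * (u T x / g x) \<le> t / g x" by simp
    moreover have "t \<le> E * (\<kappa> * u T (x - T)) / (E - 1)"
      using u_lower[of x] E by (simp add: t_def pos_le_divide_eq mult.commute)
    then have "t / g x \<le> E * (\<kappa> * u T (x - T)) / (E - 1) / g x"
      using elim by (intro divide_right_mono) auto
    then have "t / g x \<le> \<kappa> / (E - 1) * (u T (x + - T) / g (x + - T)) * E * (g (x + - T) / g x)"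
      using elim by (simp add: mult_ac)
    ultimately show ?case
      using elim by (simp add: dist_real_def t_def abs_less_iff)
  qed
qed

end

section \<open>Both tails, their common constant, and positivity\<close>

theorem theorem3:
  fixes M :: "'a measure" and A B :: "'a \<Rightarrow> real" and \<mu> :: "real measure"
    and \<kappa> \<nu> \<theta> :: real and F g :: "real \<Rightarrow> real"
  assumes "prob_space M"
    and "A \<in> borel_measurable M" and "B \<in> borel_measurable M"
    and "AE \<omega> in M. A \<omega> \<ge> 0" and "\<not> (AE \<omega> in M. A \<omega> = 1)"
    and "\<kappa> > 0"
    and "integrable M (\<lambda>\<omega>. A \<omega> powr \<kappa>)"
    and "\<theta> = moment M A \<kappa>" and "0 < \<theta>" and "\<theta> < 1"
    and "F = tilted_df M A \<kappa>"
    and "locally_subexponential F"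
    and "\<exists>K x0. \<forall>x\<ge>x0. (SUP y\<in>{x<..}. incr F 1 y) \<le> K * incr F 1 x"
    and "nonarithmetic (cond_log_law M A)"
    and "\<nu> > \<kappa>" and "integrable M (\<lambda>\<omega>. \<bar>B \<omega>\<bar> powr \<nu>)"
    and "\<forall>x. \<P>(\<omega> in M. A \<omega> * x + B \<omega> = x) < 1"
    and "perpetuity_solution M A B \<mu>"
    and "g = (\<lambda>x. F (x + 1) - F x)"
  shows "integrable (M \<Otimes>\<^sub>M \<mu>) (goldie_integrand pos_part A B \<kappa>) \<and>
    integrable (M \<Otimes>\<^sub>M \<mu>) (goldie_integrand neg_part A B \<kappa>) \<and>
    ((\<lambda>x. inverse (g (ln x)) * x powr \<kappa> * measure \<mu> {x<..}) \<longlongrightarrow>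
           \<theta> / ((1 - \<theta>)\<^sup>2 * \<kappa>) * (\<integral>p. goldie_integrand pos_part A B \<kappa> p \<partial>(M \<Otimes>\<^sub>M \<mu>))) at_top \<and>
    ((\<lambda>x. inverse (g (ln x)) * x powr \<kappa> * measure \<mu> {..- x}) \<longlongrightarrow>
           \<theta> / ((1 - \<theta>)\<^sup>2 * \<kappa>) * (\<integral>p. goldie_integrand neg_part A B \<kappa> p \<partial>(M \<Otimes>\<^sub>M \<mu>))) at_top \<and>
    ((\<integral>p. goldie_integrand pos_part A B \<kappa> p \<partial>(M \<Otimes>\<^sub>M \<mu>))
           + (\<integral>p. goldie_integrand neg_part A B \<kappa> p \<partial>(M \<Otimes>\<^sub>M \<mu>)) > 0)"
proof -
  interpret M: prob_space M by fact
  interpret \<mu>: real_distribution \<mu>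
    using assms(18) by (simp add: perpetuity_solution_def)
  interpret perpetuity M \<mu> A B \<kappa> \<nu> \<theta>
    by unfold_locales (use assms in auto)
  interpret pos: perpetuity_part M \<mu> A B \<kappa> \<nu> \<theta> pos_part
    by unfold_locales (auto simp: pos_part_def[abs_def] max_def mult_le_0_iff zero_le_mult_iff)
  interpret neg: perpetuity_part M \<mu> A B \<kappa> \<nu> \<theta> neg_part
    by unfold_locales (auto simp: neg_part_def[abs_def] max_def mult_le_0_iff zero_le_mult_iff)
  have g: "g = incr (cdf tilted_law) 1"
    using assms(11,19) by (auto simp: cdf_tilted_law incr_def)
  have law: "locally_subexponential_law tilted_law"
    using assms(11,12,13) real_distribution_tilted_law
    by (simp add: locally_subexponential_law_def locally_subexponential_law_axioms_def cdf_tilted_law)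
  have transfer: "((\<lambda>x. inverse (g (ln x)) * x powr \<kappa> * H x) \<longlongrightarrow> c) at_top"
    if "((\<lambda>x. exp (\<kappa> * x) * H (exp x) / g x) \<longlongrightarrow> c) at_top" for H c
  proof -
    have "((\<lambda>x. exp (\<kappa> * ln x) * H (exp (ln x)) / g (ln x)) \<longlongrightarrow> c) at_top"
      by (rule filterlim_compose[OF that ln_at_top])
    moreover have "\<forall>\<^sub>F x in at_top. exp (\<kappa> * ln x) * H (exp (ln x)) / g (ln x)
        = inverse (g (ln x)) * x powr \<kappa> * H x"
      using eventually_gt_at_top[of 0] by eventually_elim (simp add: powr_def field_simps)
    ultimately show ?thesis by (rule Lim_transform_eventually)
  qed
  \<comment> \<open>One factor 1 - \<theta> comes from the fixed point of the renewal equation, the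
    other from expressing the moment m through the Goldie expectation (1 - \<theta>) * m.\<close>
  have const: "\<theta> / (1 - \<theta>) * (m / \<kappa>) = \<theta> / ((1 - \<theta>)\<^sup>2 * \<kappa>) * ((1 - \<theta>) * m)" for m
    using \<theta> by (simp add: power2_eq_square)
  \<comment> \<open>Since exp x > 0, the events X > exp x and \<open>pos_part\<close> X > exp x
    coincide. The negative tail below is instead the non-strict event \<open>neg_part\<close> X
    \<ge> exp x.\<close>
  have "((\<lambda>x. exp (\<kappa> * x) * measure \<mu> {exp x<..} / g x) \<longlongrightarrow> \<theta> / (1 - \<theta>) * (pos.part_moment / \<kappa>)) at_top"
    unfolding g by (intro pos.tail_asymp law \<mu>.finite_measure_mono) (auto simp: pos_part_def less_max_iff_disj)
  then have pos_tail: "((\<lambda>x. inverse (g (ln x)) * x powr \<kappa> * measure \<mu> {x<..}) \<longlongrightarrow>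
      \<theta> / ((1 - \<theta>)\<^sup>2 * \<kappa>) * ((1 - \<theta>) * pos.part_moment)) at_top"
    unfolding const by (rule transfer)
  have "((\<lambda>x. exp (\<kappa> * x) * measure \<mu> {..- exp x} / g x) \<longlongrightarrow> \<theta> / (1 - \<theta>) * (neg.part_moment / \<kappa>)) at_top"
    unfolding g by (intro neg.tail_asymp law \<mu>.finite_measure_mono) (auto simp: neg_part_def less_max_iff_disj le_max_iff_disj)
  then have neg_tail: "((\<lambda>x. inverse (g (ln x)) * x powr \<kappa> * measure \<mu> {..- x}) \<longlongrightarrow>
      \<theta> / ((1 - \<theta>)\<^sup>2 * \<kappa>) * ((1 - \<theta>) * neg.part_moment)) at_top"
    unfolding const by (rule transfer)
  have "pos.part_moment + neg.part_moment = (\<integral>x. pos_part x powr \<kappa> + neg_part x powr \<kappa> \<partial>\<mu>)"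
    unfolding pos.part_moment_def neg.part_moment_def
    by (simp add: pos.integrable_\<phi> neg.integrable_\<phi>)
  also have "\<dots> = (\<integral>x. \<bar>x\<bar> powr \<kappa> \<partial>\<mu>)"
    by (intro Bochner_Integration.integral_cong) (auto simp: pos_part_def neg_part_def max_def)
  also have "\<dots> > 0"
    \<comment> \<open>At x = 0 the nondegeneracy hypothesis says that B = 0 has probability less
      than 1.\<close>
    using assms(17)[rule_format, of 0] by (intro moment_pos) simp
  finally have "(1 - \<theta>) * (pos.part_moment + neg.part_moment) > 0"
    using \<theta> by simp
  then show ?thesis
    using pos_tail neg_tail pos.goldie_integrand_integral neg.goldie_integrand_integral
    by (simp add: distrib_left)
qed

end
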